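(* Let $1<p<\infty$, let $m$ be a positive integer with $m<n$, let $w(x)=|x|^\theta$ on $\mathbb{R}^n$ with $1-n<\theta\le0$, let $V\in L^1_{loc}(\mathbb{R}^n)$ be non-negative, and let $\beta>0$. Then the following are equivalent. (i) There exists $C>0$ such that for any $\epsilon>0$ and any $\phi\in C_c^\infty(\mathbb{R}^n)$, $$\|V\phi\|_{L^p(w)}^p\le\epsilon\,\|\nabla^m\phi\|_{L^p(w)}^p+C\epsilon^{-\beta}\|\phi\|_{L^p(w)}^p.$$ (ii) There exists $C'>0$ such that for any $\delta>0$, $x_0\in\mathbb{R}^n$ and $\phi\in C_c^\infty(B(x_0,\delta))$, $$\|V\phi\|_{L^p(w)}^p\le C'\delta^{\frac{pm}{\beta+1}}\|\nabla^m\phi\|_{L^p(w)}^p.$$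
   Context: $\|f\|_{L^p(w)}^p=\int_{\mathbb{R}^n}|f|^pw\,dx$ (possibly $+\infty$). $\nabla^m\phi$ is the collection of all partial derivatives of $\phi$ of order $m$, with $|\nabla^m\phi|$ its Euclidean norm. $C_c^\infty(\Omega)$ is the space of smooth functions with compact support in the open set $\Omega$, and $B(x_0,\delta)$ is the ball of center $x_0$ and radius $\delta$. *)

theory Defs
  imports "HOL-Analysis.Analysis"
begin

definition partial_deriv :: "'n::finite \<Rightarrow> (real ^ 'n \<Rightarrow> real) \<Rightarrow> real ^ 'n \<Rightarrow> real" where
  "partial_deriv i f x = deriv (\<lambda>t. f (x + t *\<^sub>R axis i 1)) 0"

(* iter_partial_deriv [i1, ..., ik] f = D_i1 ... D_ik f *)
fun iter_partial_deriv :: "'n::finite list \<Rightarrow> (real ^ 'n \<Rightarrow> real) \<Rightarrow> real ^ 'n \<Rightarrow> real" where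
  "iter_partial_deriv [] f = f"
| "iter_partial_deriv (i # is) f = partial_deriv i (iter_partial_deriv is f)"

(* Differentiability below is total (Frechet) differentiability, hence it implies continuity;
   so this is C^infinity: partial derivatives of all orders exist and are continuous. *)
definition smooth :: "(real ^ 'n::finite \<Rightarrow> real) \<Rightarrow> bool" where
  "smooth f \<longleftrightarrow> (\<forall>is. iter_partial_deriv is f differentiable_on UNIV)"

(* Functions on \<Omega> are identified with their extensions by zero to the whole space. *)
definition test_functions :: "(real ^ 'n::finite) set \<Rightarrow> (real ^ 'n \<Rightarrow> real) set" where
  "test_functions \<Omega> =
     {\<phi>. smooth \<phi> \<and> compact (closure {x. \<phi> x \<noteq> 0}) \<and> closure {x. \<phi> x \<noteq> 0} \<subseteq> \<Omega>}"

(* The family of m-th order partial derivatives is the tensor (D_i1 ... D_im f), indexed by all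
   m-tuples of coordinates; for m = 2 this is the Frobenius norm of the Hessian matrix. *)
definition grad_norm :: "nat \<Rightarrow> (real ^ 'n::finite \<Rightarrow> real) \<Rightarrow> real ^ 'n \<Rightarrow> real" where
  "grad_norm m f x = L2_set (\<lambda>is. iter_partial_deriv is f x) {is. length is = m}"

definition Lp_norm_pow :: "real \<Rightarrow> (real ^ 'n::finite \<Rightarrow> real) \<Rightarrow> (real ^ 'n \<Rightarrow> real) \<Rightarrow> ennreal" where
  "Lp_norm_pow p w f = (\<integral>\<^sup>+x. ennreal (\<bar>f x\<bar> powr p * w x) \<partial>lebesgue)"

(* At the origin 0 powr \<theta> = 0, also for \<theta> \<le> 0; this only concerns a null set. *)
definition power_weight :: "real \<Rightarrow> real ^ 'n::finite \<Rightarrow> real" where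
  "power_weight \<theta> x = norm x powr \<theta>"

definition L1_loc :: "(real ^ 'n::finite \<Rightarrow> real) \<Rightarrow> bool" where
  "L1_loc V \<longleftrightarrow> (\<forall>K. compact K \<longrightarrow> V absolutely_integrable_on K)"

end

theory Submission
  imports Defs
begin

text \<open>The two conditions are linked by the scale at which they are tested: \<open>\<epsilon>\<close> corresponds to
\<open>\<delta> powr (p * m / (\<beta> + 1))\<close>. At this scale two classical inequalities for the weight \<open>\<bar>x\<bar> powr \<theta>\<close> are
needed. From (i) to (ii) it is the Poincare inequality of order \<open>m\<close> (\<open>poincare\<close>): for functions
supported in a ball of radius \<open>\<delta>\<close>, the term without derivatives is bounded by \<open>\<delta> powr (p * m)\<close> times
the term with derivatives of order \<open>m\<close>. From (ii) to (i) it is the interpolation inequality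
(\<open>interpolation\<close>): the energy of intermediate order \<open>j\<close> is bounded by the energies of order \<open>m\<close> and
\<open>0\<close>, with the powers of \<open>\<delta>\<close> that scaling dictates. Given the latter, the local estimate is applied
to \<open>\<phi>\<close> multiplied by a cutoff of size \<open>\<delta>\<close> around a point \<open>a\<close> and integrated over all \<open>a\<close>. By
Tonelli's theorem (\<open>nn_integral_average_cutoff\<close>) this recovers the full norms of the derivatives of
\<open>\<phi>\<close>, and the derivatives of the cutoff cost exactly the powers of \<open>\<delta>\<close> that interpolation provides
(\<open>average_energy_cutoff_le\<close>).

Both inequalities are proved by the same division of space. Where \<open>\<bar>x\<bar> \<ge> \<delta>\<close>, moving a point by at
most \<open>2 * \<delta>\<close> lowers the weight at most by a constant factor (\<open>nn_integral_translate_pweight_far\<close>),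
so the unweighted proofs along coordinate segments apply. Where \<open>\<bar>x\<bar> < \<delta>\<close> they fail: for \<open>\<theta> \<le> - 1\<close>
the weight is not integrable near the origin along a coordinate axis. There the points \<open>x\<close> and
\<open>2 * x\<close> are compared instead (\<open>energy_near_le\<close>). The weighted measure is homogeneous of the positive
degree \<open>n + \<theta>\<close>, so that the dilation by \<open>2\<close> contributes a factor less than \<open>1\<close>; the energy on the
ball is therefore absorbed, up to its counterpart outside the ball and \<open>\<delta> powr p\<close> times the energy
of the gradient.\<close>

section \<open>Inequalities for p-th powers on an interval\<close>

text \<open>The factor in front of \<open>a powr p\<close> can be brought as close to \<open>1\<close> as desired. This is what allows the
term containing \<open>a\<close> to be absorbed later: compare \<open>b\<close> with \<open>\<tau> * a\<close>.\<close>

lemma powr_add_le_weighted: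
  fixes a b \<tau> p :: real
  assumes "0 \<le> a" "0 \<le> b" "0 < \<tau>" "0 \<le> p"
  shows "(a + b) powr p \<le> (1 + \<tau>) powr p * a powr p + (1 + 1/\<tau>) powr p * b powr p"
proof (cases "b \<le> \<tau> * a")
  case True
  then have "a + b \<le> (1 + \<tau>) * a" by (simp add: algebra_simps)
  then have "(a + b) powr p \<le> ((1 + \<tau>) * a) powr p"
    using assms by (intro powr_mono2) auto
  also have "\<dots> = (1 + \<tau>) powr p * a powr p"
    using assms by (simp add: powr_mult)
  finally show ?thesis by (smt (verit) mult_nonneg_nonneg powr_ge_zero)
next
  case False
  then have "a + b \<le> (1 + 1/\<tau>) * b" using assms by (simp add: field_simps)
  then have "(a + b) powr p \<le> ((1 + 1/\<tau>) * b) powr p"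
    using assms by (intro powr_mono2) auto
  also have "\<dots> = (1 + 1/\<tau>) powr p * b powr p"
    using assms by (simp add: powr_mult)
  finally show ?thesis by (smt (verit) mult_nonneg_nonneg powr_ge_zero)
qed

lemma powr_sum_le:
  fixes a :: "'i \<Rightarrow> real"
  assumes "finite A" "\<And>i. i \<in> A \<Longrightarrow> 0 \<le> a i" "0 < p"
  shows "(\<Sum>i\<in>A. a i) powr p \<le> real (card A) powr p * (\<Sum>i\<in>A. a i powr p)"
proof (cases "A = {}")
  case False
  define M where "M = Max (a ` A)"
  have M: "M \<in> a ` A" "\<And>i. i \<in> A \<Longrightarrow> a i \<le> M"
    using assms False by (auto simp: M_def)
  then obtain k where k: "k \<in> A" "M = a k" by auto
  have "(\<Sum>i\<in>A. a i) powr p \<le> (real (card A) * M) powr p"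
    using assms M by (intro powr_mono2 sum_nonneg sum_bounded_above) auto
  also have "\<dots> = real (card A) powr p * M powr p"
    using assms k by (simp add: powr_mult)
  also have "M powr p \<le> (\<Sum>i\<in>A. a i powr p)"
    unfolding k(2) using assms k by (intro member_le_sum) auto
  finally show ?thesis by (simp add: mult_left_mono)
qed auto

text \<open>The tangent at \<open>A\<close> to the convex function \<open>y \<mapsto> \<bar>y\<bar> powr p\<close>, obtained from Young's inequality.
Integrating it gives Jensen's inequality without any approximation argument.\<close>

lemma powr_above_tangent:
  fixes y A p :: real
  assumes "1 < p" "0 \<le> A"
  shows "p * A powr (p - 1) * y - (p - 1) * A powr p \<le> \<bar>y\<bar> powr p"
proof -
  have "\<bar>y\<bar> * A powr (p - 1) \<le> \<bar>y\<bar> powr p / p + (A powr (p - 1)) powr (p / (p - 1)) / (p / (p - 1))"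
    using assms by (intro Youngs_inequality) (auto simp: field_simps)
  also have "(A powr (p - 1)) powr (p / (p - 1)) = A powr p"
    using assms by (simp add: powr_powr)
  finally have "p * (\<bar>y\<bar> * A powr (p - 1)) \<le> \<bar>y\<bar> powr p + (p - 1) * A powr p"
    using assms by (simp add: field_simps)
  moreover have "y * A powr (p - 1) \<le> \<bar>y\<bar> * A powr (p - 1)"
    by (intro mult_right_mono) auto
  then have "p * (y * A powr (p - 1)) \<le> p * (\<bar>y\<bar> * A powr (p - 1))"
    using assms by (intro mult_left_mono) auto
  ultimately show ?thesis by (simp add: algebra_simps)
qed

text \<open>Jensen's inequality applied to the fundamental theorem of calculus. With \<open>A = \<bar>g \<xi> - g 0\<bar>\<close>, the
tangent at \<open>A\<close> is integrated over \<open>{0..\<xi>}\<close>; it yields \<open>(p - \<xi> * (p - 1)) * A powr p\<close>, and this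
factor is at least \<open>1\<close> for \<open>\<xi> \<le> 1\<close>. The right-hand side is an integral in \<open>ennreal\<close>, ready for
Tonelli's theorem.\<close>

lemma increment_powr_le_nn_integral:
  fixes g g' :: "real \<Rightarrow> real"
  assumes p: "1 < p" and \<xi>: "0 \<le> \<xi>" "\<xi> \<le> 1"
    and g: "\<And>s. (g has_real_derivative g' s) (at s)"
    and cont: "continuous_on UNIV g'"
  shows "ennreal (\<bar>g \<xi> - g 0\<bar> powr p) \<le> (\<integral>\<^sup>+s. indicator {0..1} s * ennreal (\<bar>g' s\<bar> powr p) \<partial>lborel)"
proof -
  define A where "A = \<bar>g \<xi> - g 0\<bar>"
  define \<sigma> where "\<sigma> = sgn (g \<xi> - g 0)"
  have A0: "0 \<le> A" by (simp add: A_def)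
  have cont_p: "continuous_on S (\<lambda>s. \<bar>g' s\<bar> powr p)" for S
    using p by (intro continuous_on_powr' continuous_on_subset[OF continuous_on_rabs[OF cont]] continuous_on_const) auto
  have g'_int: "(g' has_integral (g \<xi> - g 0)) {0..\<xi>}"
    using \<xi> g by (intro fundamental_theorem_of_calculus)
      (auto simp: has_real_derivative_iff_has_vector_derivative[symmetric] intro: has_field_derivative_at_within)
  have const_int: "((\<lambda>s. (p - 1) * A powr p) has_integral (\<xi> - 0) *\<^sub>R ((p - 1) * A powr p)) {0..\<xi>}"
    using \<xi> has_integral_const_real[of "(p - 1) * A powr p" 0 \<xi>] by simp
  have "((\<lambda>s. p * A powr (p - 1) * (\<sigma> * g' s) - (p - 1) * A powr p) has_integral
      (p * A powr (p - 1) * (\<sigma> * (g \<xi> - g 0)) - (\<xi> - 0) *\<^sub>R ((p - 1) * A powr p))) {0..\<xi>}"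
    by (intro has_integral_diff has_integral_mult_right g'_int const_int)
  moreover have "((\<lambda>s. \<bar>g' s\<bar> powr p) has_integral integral {0..\<xi>} (\<lambda>s. \<bar>g' s\<bar> powr p)) {0..\<xi>}"
    by (intro integrable_integral integrable_continuous_interval cont_p)
  ultimately have main: "p * A powr (p - 1) * (\<sigma> * (g \<xi> - g 0)) - (\<xi> - 0) *\<^sub>R ((p - 1) * A powr p)
      \<le> integral {0..\<xi>} (\<lambda>s. \<bar>g' s\<bar> powr p)"
  proof (rule has_integral_le)
    fix s
    have "\<bar>\<sigma> * g' s\<bar> powr p \<le> \<bar>g' s\<bar> powr p"
      using p by (intro powr_mono2) (auto simp: \<sigma>_def abs_mult sgn_real_def)
    then show "p * A powr (p - 1) * (\<sigma> * g' s) - (p - 1) * A powr p \<le> \<bar>g' s\<bar> powr p"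
      using powr_above_tangent[OF p A0, of "\<sigma> * g' s"] by linarith
  qed
  have \<sigma>A: "\<sigma> * (g \<xi> - g 0) = A" by (simp add: \<sigma>_def A_def mult_sgn_abs sgn_mult_abs) (simp add: abs_sgn mult.commute)
  have powA: "A powr (p - 1) * A = A powr p"
    using A0 p by (cases "A = 0") (auto simp: powr_diff)
  have "p * (A powr (p - 1) * A) - \<xi> * ((p - 1) * A powr p) \<le> integral {0..\<xi>} (\<lambda>s. \<bar>g' s\<bar> powr p)"
    using main unfolding \<sigma>A by (simp add: mult.assoc)
  then have "(p - \<xi> * (p - 1)) * A powr p \<le> integral {0..\<xi>} (\<lambda>s. \<bar>g' s\<bar> powr p)"
    unfolding powA by (simp add: algebra_simps)
  moreover have "1 * A powr p \<le> (p - \<xi> * (p - 1)) * A powr p"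
  proof (intro mult_right_mono)
    have "\<xi> * (p - 1) \<le> 1 * (p - 1)" using p \<xi> by (intro mult_right_mono) auto
    then show "1 \<le> p - \<xi> * (p - 1)" by (simp add: algebra_simps)
  qed simp
  moreover have "integral {0..\<xi>} (\<lambda>s. \<bar>g' s\<bar> powr p) \<le> integral {0..1} (\<lambda>s. \<bar>g' s\<bar> powr p)"
    using \<xi> by (intro integral_subset_le integrable_continuous_interval cont_p) auto
  ultimately have *: "A powr p \<le> integral {0..1} (\<lambda>s. \<bar>g' s\<bar> powr p)" by linarith
  have "(\<integral>\<^sup>+s. ennreal (indicator {0..1} s * \<bar>g' s\<bar> powr p) \<partial>lborel)
      = ennreal (integral {0..1} (\<lambda>s. \<bar>g' s\<bar> powr p))"
    by (intro nn_integral_has_integral_lebesgue integrable_integral integrable_continuous_interval cont_p) auto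
  with * show ?thesis
    by (simp add: A_def ennreal_leI ennreal_mult' ennreal_indicator)
qed

text \<open>One-dimensional interpolation: by the mean value theorem \<open>g'\<close> equals \<open>g 1 - g 0\<close> at some point \<open>\<xi>\<close>,
and the passage from \<open>\<xi>\<close> to \<open>0\<close> costs an integral of the second derivative.\<close>

lemma derivative_powr_le_nn_integral:
  fixes g g' g'' :: "real \<Rightarrow> real"
  assumes p: "1 < p"
    and g: "\<And>s. (g has_real_derivative g' s) (at s)"
    and g': "\<And>s. (g' has_real_derivative g'' s) (at s)"
    and cont: "continuous_on UNIV g''"
  shows "ennreal (\<bar>g' 0\<bar> powr p) \<le> ennreal (3 powr p) * (ennreal (\<bar>g 1\<bar> powr p) + ennreal (\<bar>g 0\<bar> powr p)
     + (\<integral>\<^sup>+s. indicator {0..1} s * ennreal (\<bar>g'' s\<bar> powr p) \<partial>lborel))"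
proof -
  obtain \<xi> where \<xi>: "0 < \<xi>" "\<xi> < 1" "g 1 - g 0 = g' \<xi>"
    using MVT2[of 0 1 g g'] g by auto
  define a where "a = (\<lambda>i::nat. [\<bar>g 1\<bar>, \<bar>g 0\<bar>, \<bar>g' \<xi> - g' 0\<bar>] ! i)"
  have a_nonneg: "0 \<le> a i" if "i < 3" for i
    using that by (auto simp: a_def less_Suc_eq eval_nat_numeral)
  have "\<bar>g' 0\<bar> powr p \<le> (\<Sum>i<3. a i) powr p"
    using p \<xi>(3) by (intro powr_mono2) (auto simp: a_def eval_nat_numeral)
  also have "\<dots> \<le> 3 powr p * (\<Sum>i<3. a i powr p)"
    using powr_sum_le[of "{..<3}" a p] p a_nonneg by simp
  also have "\<dots> = 3 powr p * (\<bar>g 1\<bar> powr p + \<bar>g 0\<bar> powr p + \<bar>g' \<xi> - g' 0\<bar> powr p)"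
    by (simp add: a_def eval_nat_numeral)
  finally have "ennreal (\<bar>g' 0\<bar> powr p) \<le> ennreal (3 powr p) *
      (ennreal (\<bar>g 1\<bar> powr p) + ennreal (\<bar>g 0\<bar> powr p) + ennreal (\<bar>g' \<xi> - g' 0\<bar> powr p))"
    by (simp add: ennreal_mult[symmetric] ennreal_plus[symmetric] ennreal_leI del: ennreal_plus)
  also have "\<dots> \<le> ennreal (3 powr p) * (ennreal (\<bar>g 1\<bar> powr p) + ennreal (\<bar>g 0\<bar> powr p)
     + (\<integral>\<^sup>+s. indicator {0..1} s * ennreal (\<bar>g'' s\<bar> powr p) \<partial>lborel))"
    using \<xi> by (intro mult_left_mono add_left_mono increment_powr_le_nn_integral[OF p _ _ g' cont]) auto
  finally show ?thesis .
qed

lemma ennreal_absorb: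
  fixes a b :: ennreal and q :: real
  assumes "a \<le> ennreal q * a + b" "a < \<infinity>" "0 \<le> q" "q < 1"
  shows "a \<le> ennreal (1 / (1 - q)) * b"
proof (cases b)
  case (real r)
  obtain s where s: "a = ennreal s" "0 \<le> s" using assms(2) by (cases a) auto
  have "ennreal s \<le> ennreal (q * s + r)"
    using assms(1) unfolding s(1) real using s(2) real assms(3) by (simp add: ennreal_mult)
  then have "s \<le> q * s + r" using s real assms by (subst (asm) ennreal_le_iff) auto
  then have "s \<le> 1 / (1 - q) * r" using assms by (simp add: field_simps)
  then show ?thesis using s real assms by (simp add: ennreal_mult[symmetric] ennreal_leI)
next
  case top
  then show ?thesis using assms by (simp add: ennreal_mult_top)
qed

section \<open>Calculus of smooth functions and test functions\<close>

lemma iter_partial_deriv_append: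
  "iter_partial_deriv (is @ js) f = iter_partial_deriv is (iter_partial_deriv js f)"
  by (induction "is") auto

lemma smooth_iter_partial_deriv: "smooth f \<Longrightarrow> smooth (iter_partial_deriv js f)"
  unfolding smooth_def by (metis iter_partial_deriv_append)

lemma smooth_differentiable: "smooth f \<Longrightarrow> f differentiable (at x)"
  unfolding smooth_def by (metis iter_partial_deriv.simps(1) UNIV_I differentiable_on_def)

lemma smooth_continuous_on: "smooth f \<Longrightarrow> continuous_on S f"
  by (intro continuous_at_imp_continuous_on ballI differentiable_imp_continuous_within smooth_differentiable)

lemma smooth_borel_measurable [measurable_dest]: "smooth f \<Longrightarrow> f \<in> borel_measurable borel"
  by (intro borel_measurable_continuous_onI smooth_continuous_on)

text \<open>The partial derivatives are the entries of the total derivative; hence derivatives of \<open>f\<close> along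
segments in any direction are expressed by them.\<close>

lemma has_derivative_partial_deriv:
  fixes f :: "real ^ 'n::finite \<Rightarrow> real"
  assumes "f differentiable (at x)"
  shows "(f has_derivative (\<lambda>y. \<Sum>i\<in>UNIV. y $ i * partial_deriv i f x)) (at x)"
proof -
  obtain f' where f': "(f has_derivative f') (at x)"
    using assms by (auto simp: differentiable_def)
  then have lin: "linear f'" by (rule has_derivative_linear)
  have pd: "partial_deriv i f x = f' (axis i 1)" for i
  proof -
    have "((\<lambda>t. f (x + t *\<^sub>R axis i 1)) has_derivative (\<lambda>t. f' (t *\<^sub>R axis i 1))) (at 0)"
      by (rule has_derivative_compose[of "\<lambda>t. x + t *\<^sub>R axis i 1"])
        (use f' in \<open>auto intro!: derivative_eq_intros\<close>)
    then have "((\<lambda>t. f (x + t *\<^sub>R axis i 1)) has_real_derivative f' (axis i 1)) (at 0)"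
      by (simp add: has_field_derivative_def linear_scale[OF lin] mult_commute_abs)
    then show ?thesis unfolding partial_deriv_def by (rule DERIV_imp_deriv)
  qed
  have "f' y = (\<Sum>i\<in>UNIV. y $ i * partial_deriv i f x)" for y
  proof -
    have "f' y = f' (\<Sum>i\<in>UNIV. y $ i *\<^sub>R axis i 1)"
      by (simp add: basis_expansion[of y, unfolded scalar_mult_eq_scaleR])
    then show ?thesis by (simp add: linear_sum[OF lin] linear_scale[OF lin] pd)
  qed
  then have "f' = (\<lambda>y. \<Sum>i\<in>UNIV. y $ i * partial_deriv i f x)" by blast
  with f' show ?thesis by simp
qed

lemma has_real_derivative_along_line:
  fixes f :: "real ^ 'n::finite \<Rightarrow> real"
  assumes "smooth f"
  shows "((\<lambda>s. f (x + s *\<^sub>R y)) has_real_derivative (\<Sum>i\<in>UNIV. y $ i * partial_deriv i f (x + s *\<^sub>R y))) (at s)"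
proof -
  have "((\<lambda>s. f (x + s *\<^sub>R y)) has_derivative
      (\<lambda>t. \<Sum>i\<in>UNIV. (t *\<^sub>R y) $ i * partial_deriv i f (x + s *\<^sub>R y))) (at s)"
    by (rule has_derivative_compose[OF _ has_derivative_partial_deriv[OF smooth_differentiable[OF assms]]])
      (auto intro!: derivative_eq_intros)
  moreover have "(\<lambda>t. \<Sum>i\<in>UNIV. (t *\<^sub>R y) $ i * partial_deriv i f (x + s *\<^sub>R y))
      = (*) (\<Sum>i\<in>UNIV. y $ i * partial_deriv i f (x + s *\<^sub>R y))"
    by (auto simp: sum_distrib_left sum_distrib_right mult_ac fun_eq_iff)
  ultimately show ?thesis by (simp add: has_field_derivative_def)
qed

lemma smooth_partial_deriv: "smooth f \<Longrightarrow> smooth (partial_deriv i f)"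
  using smooth_iter_partial_deriv[of f "[i]"] by simp

lemma sum_axis_mult: "(\<Sum>j\<in>UNIV. axis i h $ j * F j) = (h::real) * F i"
  by (subst sum.remove[of _ i]) (auto simp: axis_def intro!: sum.neutral)

lemma has_real_derivative_along_axis:
  fixes f :: "real ^ 'n::finite \<Rightarrow> real"
  assumes "smooth f"
  shows "((\<lambda>s. f (x + s *\<^sub>R axis i h)) has_real_derivative h * partial_deriv i f (x + s *\<^sub>R axis i h)) (at s)"
  using has_real_derivative_along_line[OF assms, of x "axis i h" s]
  by (simp add: sum_axis_mult)

lemma partial_deriv_eq_0_outside_support:
  assumes "x \<notin> closure {x. f x \<noteq> 0}"
  shows "partial_deriv i f x = 0"
proof -
  have "open (- closure {x. f x \<noteq> 0})" by auto
  moreover have "continuous (at 0) (\<lambda>t::real. x + t *\<^sub>R axis i 1)"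
    by (intro continuous_intros)
  ultimately have "eventually (\<lambda>t::real. x + t *\<^sub>R axis i 1 \<in> - closure {x. f x \<noteq> 0}) (nhds 0)"
    using assms unfolding continuous_at_open eventually_nhds by (metis ComplI add.right_neutral scaleR_zero_left)
  then have "eventually (\<lambda>t::real. f (x + t *\<^sub>R axis i 1) = 0) (nhds 0)"
    by (rule eventually_mono) (auto dest: contra_subsetD[OF closure_subset])
  then have "deriv (\<lambda>t::real. f (x + t *\<^sub>R axis i 1)) 0 = deriv (\<lambda>t::real. 0) (0::real)"
    by (intro deriv_cong_ev) auto
  then show ?thesis by (simp add: partial_deriv_def)
qed

text \<open>A criterion that avoids computing the closure of the set where the function does not vanish.\<close>

lemma test_functions_subset_support:
  assumes "smooth g" "{x. g x \<noteq> 0} \<subseteq> K" "compact K" "K \<subseteq> \<Omega>"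
  shows "g \<in> test_functions \<Omega>"
proof -
  have "closure {x. g x \<noteq> 0} \<subseteq> K"
    using assms by (intro closure_minimal compact_imp_closed) auto
  then show ?thesis using assms
    by (auto simp: test_functions_def intro: compact_closure[THEN iffD2] bounded_subset compact_imp_bounded)
qed

lemma test_functions_partial_deriv:
  assumes "f \<in> test_functions \<Omega>" shows "partial_deriv i f \<in> test_functions \<Omega>"
proof (rule test_functions_subset_support)
  show "{x. partial_deriv i f x \<noteq> 0} \<subseteq> closure {x. f x \<noteq> 0}"
    using partial_deriv_eq_0_outside_support by blast
qed (use assms in \<open>auto simp: test_functions_def smooth_partial_deriv\<close>)

lemma test_functions_iter_partial_deriv:
  "f \<in> test_functions \<Omega> \<Longrightarrow> iter_partial_deriv is f \<in> test_functions \<Omega>"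
  by (induction "is") (auto simp: test_functions_partial_deriv)

lemma test_functions_smooth: "f \<in> test_functions \<Omega> \<Longrightarrow> smooth f"
  by (simp add: test_functions_def)

lemma test_functions_mono: "f \<in> test_functions \<Omega> \<Longrightarrow> \<Omega> \<subseteq> \<Omega>' \<Longrightarrow> f \<in> test_functions \<Omega>'"
  by (auto simp: test_functions_def)

lemma test_functions_UNIV: "f \<in> test_functions \<Omega> \<Longrightarrow> f \<in> test_functions UNIV"
  by (rule test_functions_mono) auto

text \<open>One entry for each way to distribute the differentiations \<open>is\<close> over the two factors of a product.
The entries form a list since different distributions may produce equal pairs, which have to be
counted with multiplicity in the Leibniz rule.\<close>

fun leibniz_splits :: "'i list \<Rightarrow> ('i list \<times> 'i list) list" where
  "leibniz_splits [] = [([], [])]"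
| "leibniz_splits (i # is) =
     map (apfst ((#) i)) (leibniz_splits is) @ map (apsnd ((#) i)) (leibniz_splits is)"

lemma length_leibniz_splits: "(js, ks) \<in> set (leibniz_splits is) \<Longrightarrow> length js + length ks = length is"
  by (induction "is" arbitrary: js ks) auto

lemma partial_deriv_mult:
  assumes "f differentiable (at x)" "g differentiable (at x)"
  shows "partial_deriv i (\<lambda>x. f x * g x) x = partial_deriv i f x * g x + f x * partial_deriv i g x"
proof -
  have d: "((\<lambda>t. f (x + t *\<^sub>R axis i 1)) has_real_derivative partial_deriv i f x) (at 0)"
    if "f differentiable (at x)" for f
  proof -
    have "((\<lambda>t. f (x + t *\<^sub>R axis i 1)) has_derivative
        (\<lambda>t. \<Sum>j\<in>UNIV. (t *\<^sub>R axis i 1) $ j * partial_deriv j f x)) (at 0)"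
      by (rule has_derivative_compose[of "\<lambda>t. x + t *\<^sub>R axis i 1"])
        (use has_derivative_partial_deriv[OF that] in \<open>auto intro!: derivative_eq_intros\<close>)
    then show ?thesis
      by (simp add: has_field_derivative_def mult.assoc sum_distrib_left[symmetric] sum_axis_mult mult_commute_abs)
  qed
  show ?thesis
    unfolding partial_deriv_def[of i "\<lambda>x. f x * g x"]
    by (rule DERIV_imp_deriv) (auto intro!: derivative_eq_intros d assms)
qed

lemma partial_deriv_add:
  assumes "f differentiable (at x)" "g differentiable (at x)"
  shows "partial_deriv i (\<lambda>x. f x + g x) x = partial_deriv i f x + partial_deriv i g x"
proof -
  have "((\<lambda>x. f x + g x) has_derivative (\<lambda>y. (\<Sum>i\<in>UNIV. y $ i * partial_deriv i f x) + (\<Sum>i\<in>UNIV. y $ i * partial_deriv i g x))) (at x)"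
    by (intro has_derivative_add has_derivative_partial_deriv assms)
  moreover from this have "((\<lambda>x. f x + g x) has_derivative (\<lambda>y. \<Sum>i\<in>UNIV. y $ i * partial_deriv i (\<lambda>x. f x + g x) x)) (at x)"
    by (intro has_derivative_partial_deriv) (auto simp: differentiable_def)
  ultimately have "(\<lambda>y. (\<Sum>i\<in>UNIV. y $ i * partial_deriv i f x) + (\<Sum>i\<in>UNIV. y $ i * partial_deriv i g x))
     = (\<lambda>y. \<Sum>i\<in>UNIV. y $ i * partial_deriv i (\<lambda>x. f x + g x) x)"
    by (rule has_derivative_unique)
  from fun_cong[OF this, of "axis i 1"] show ?thesis by (simp add: sum_axis_mult)
qed

lemma partial_deriv_sum_list:
  assumes "\<And>a. a \<in> set as \<Longrightarrow> F a differentiable (at x)"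
  shows "partial_deriv i (\<lambda>x. \<Sum>a\<leftarrow>as. F a x) x = (\<Sum>a\<leftarrow>as. partial_deriv i (F a) x)
    \<and> (\<lambda>x. \<Sum>a\<leftarrow>as. F a x) differentiable (at x)"
  using assms
proof (induction as)
  case Nil
  then show ?case by (simp add: partial_deriv_def)
next
  case (Cons a as)
  then show ?case by (simp add: partial_deriv_add)
qed

lemma iter_partial_deriv_mult:
  assumes f: "smooth f" and g: "smooth g"
  shows "iter_partial_deriv is (\<lambda>x. f x * g x) =
    (\<lambda>x. \<Sum>(js, ks)\<leftarrow>leibniz_splits is. iter_partial_deriv js f x * iter_partial_deriv ks g x)"
proof (induction "is")
  case (Cons i "is")
  have diff: "iter_partial_deriv js f differentiable (at x)" "iter_partial_deriv js g differentiable (at x)" for js x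
    using f g by (auto intro: smooth_differentiable smooth_iter_partial_deriv)
  show ?case
    by (simp add: Cons fun_eq_iff case_prod_unfold partial_deriv_sum_list diff partial_deriv_mult
        sum_list_addf comp_def)
qed simp

lemma smooth_mult:
  assumes "smooth f" "smooth g" shows "smooth (\<lambda>x. f x * g x)"
proof -
  have "iter_partial_deriv js f differentiable (at x)" "iter_partial_deriv js g differentiable (at x)" for js x
    using assms by (auto intro: smooth_differentiable smooth_iter_partial_deriv)
  then show ?thesis unfolding smooth_def iter_partial_deriv_mult[OF assms]
    by (auto simp: differentiable_on_def case_prod_unfold intro!: partial_deriv_sum_list[THEN conjunct2] differentiable_mult)
qed

lemma iter_partial_deriv_affine:
  fixes f :: "real ^ 'n::finite \<Rightarrow> real"
  assumes f: "smooth f"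
  shows "iter_partial_deriv is (\<lambda>x. f (c *\<^sub>R (x - a))) = (\<lambda>x. c ^ length is * iter_partial_deriv is f (c *\<^sub>R (x - a)))"
proof (induction "is")
  case (Cons i "is")
  have axis_c: "axis i c = c *\<^sub>R axis i (1::real)" by (simp add: axis_def vec_eq_iff)
  have "((\<lambda>t. c ^ length is * iter_partial_deriv is f (c *\<^sub>R (x + t *\<^sub>R axis i 1 - a))) has_real_derivative
     c ^ length is * (c * partial_deriv i (iter_partial_deriv is f) (c *\<^sub>R (x - a)))) (at 0)" for x
    using DERIV_cmult[OF has_real_derivative_along_axis[OF smooth_iter_partial_deriv[OF f, of "is"], of "c *\<^sub>R (x - a)" i c 0], of "c ^ length is"]
    by (simp add: axis_c algebra_simps)
  then show ?case
    by (auto simp: Cons partial_deriv_def[of i "\<lambda>x. c ^ length is * iter_partial_deriv is f (c *\<^sub>R (x - a))"] fun_eq_iff mult_ac intro!: DERIV_imp_deriv)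
qed simp

lemma smooth_affine:
  fixes f :: "real ^ 'n::finite \<Rightarrow> real"
  assumes "smooth f" shows "smooth (\<lambda>x. f (c *\<^sub>R (x - a)))"
proof -
  have "(\<lambda>x. iter_partial_deriv is f (c *\<^sub>R (x - a))) differentiable (at x)" for "is" x
    by (rule differentiable_compose[where g = "\<lambda>x. c *\<^sub>R (x - a)"])
      (auto intro: smooth_differentiable smooth_iter_partial_deriv assms)
  then show ?thesis unfolding smooth_def iter_partial_deriv_affine[OF assms]
    by (auto simp: differentiable_on_def intro!: differentiable_mult)
qed

lemma test_functions_mult_cutoff:
  fixes \<phi> \<eta> :: "real ^ 'n::finite \<Rightarrow> real"
  assumes \<phi>: "smooth \<phi>" and \<eta>: "\<eta> \<in> test_functions (ball 0 R)" and c: "0 < c"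
  shows "(\<lambda>x. \<phi> x * \<eta> (c *\<^sub>R (x - a))) \<in> test_functions (ball a (R / c))"
proof -
  define K where "K = (\<lambda>y. a + (1/c) *\<^sub>R y) ` closure {x. \<eta> x \<noteq> 0}"
  show ?thesis
  proof (rule test_functions_subset_support)
    show "smooth (\<lambda>x. \<phi> x * \<eta> (c *\<^sub>R (x - a)))"
      using assms by (intro smooth_mult smooth_affine) (auto simp: test_functions_def)
    show "compact K" unfolding K_def
      using \<eta> by (intro compact_continuous_image continuous_intros) (auto simp: test_functions_def)
    show "{x. \<phi> x * \<eta> (c *\<^sub>R (x - a)) \<noteq> 0} \<subseteq> K"
    proof
      fix x assume "x \<in> {x. \<phi> x * \<eta> (c *\<^sub>R (x - a)) \<noteq> 0}"
      then have "c *\<^sub>R (x - a) \<in> closure {x. \<eta> x \<noteq> 0}" using closure_subset by fastforce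
      moreover have "x = a + (1/c) *\<^sub>R (c *\<^sub>R (x - a))" using c by simp
      ultimately show "x \<in> K" unfolding K_def by blast
    qed
    show "K \<subseteq> ball a (R / c)"
      using \<eta> c by (auto simp: K_def test_functions_def dist_norm subset_iff divide_right_mono field_simps)
  qed
qed

section \<open>Translations and dilations of the weight\<close>

text \<open>Valued in \<open>ennreal\<close> for use in nonnegative integrals. At the origin it is \<open>0\<close>, because
\<open>0 powr \<theta> = 0\<close> for every \<open>\<theta>\<close>.\<close>

definition pweight :: "real \<Rightarrow> 'a::euclidean_space \<Rightarrow> ennreal" where
  "pweight \<theta> x = ennreal (norm x powr \<theta>)"

lemma pweight_measurable [measurable]: "pweight \<theta> \<in> borel_measurable borel"
  unfolding pweight_def by measurable

lemma Lp_norm_pow_eq: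
  "Lp_norm_pow p (power_weight \<theta>) f = (\<integral>\<^sup>+x. ennreal (\<bar>f x\<bar> powr p) * pweight \<theta> x \<partial>lborel)"
  by (simp add: Lp_norm_pow_def power_weight_def pweight_def nn_integral_completion ennreal_mult)

lemma nn_integral_lborel_translate:
  fixes F :: "'a::euclidean_space \<Rightarrow> ennreal"
  assumes [measurable]: "F \<in> borel_measurable borel"
  shows "(\<integral>\<^sup>+x. F (x + a) \<partial>lborel) = (\<integral>\<^sup>+x. F x \<partial>lborel)"
proof -
  have "(\<integral>\<^sup>+x. F x \<partial>lborel) = (\<integral>\<^sup>+x. F x \<partial>(distr lborel borel ((+) a)))"
    by (simp add: lborel_distr_plus)
  also have "\<dots> = (\<integral>\<^sup>+x. F (a + x) \<partial>lborel)" by (subst nn_integral_distr) auto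
  finally show ?thesis by (simp add: add.commute)
qed

lemma nn_integral_lborel_dilate:
  fixes F :: "'a::euclidean_space \<Rightarrow> ennreal"
  assumes [measurable]: "F \<in> borel_measurable borel" and c: "c \<noteq> 0"
  shows "(\<integral>\<^sup>+x. F x \<partial>lborel) = ennreal (\<bar>c\<bar> ^ DIM('a)) * (\<integral>\<^sup>+x. F (c *\<^sub>R x) \<partial>lborel)"
proof -
  have "(\<integral>\<^sup>+x. F x \<partial>lborel)
      = (\<integral>\<^sup>+x. F x \<partial>(density (distr lborel borel (\<lambda>x. c *\<^sub>R x)) (\<lambda>_. ennreal (\<bar>c\<bar> ^ DIM('a)))))"
    using lborel_affine[OF c, of "0::'a"] by simp
  also have "\<dots> = (\<integral>\<^sup>+x. ennreal (\<bar>c\<bar> ^ DIM('a)) * F (c *\<^sub>R x) \<partial>lborel)"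
    by (simp add: nn_integral_density nn_integral_distr)
  finally show ?thesis by (simp add: nn_integral_cmult)
qed

text \<open>The measure with density \<open>\<bar>x\<bar> powr \<theta>\<close> is homogeneous of degree \<open>DIM('a) + \<theta>\<close>. For a positive degree,
pulling a function back by a dilation with factor \<open>2\<close> shrinks its integral by a fixed factor less
than \<open>1\<close>; every absorption near the origin rests on this.\<close>

lemma nn_integral_dilate_pweight:
  fixes F :: "'a::euclidean_space \<Rightarrow> ennreal"
  assumes [measurable]: "F \<in> borel_measurable borel" and c: "0 < c"
  shows "(\<integral>\<^sup>+x. F (c *\<^sub>R x) * pweight \<theta> x \<partial>lborel)
    = ennreal (c powr (- (real DIM('a) + \<theta>))) * (\<integral>\<^sup>+x. F x * pweight \<theta> x \<partial>lborel)"
proof -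
  have w: "pweight \<theta> x = ennreal (c powr - \<theta>) * pweight \<theta> (c *\<^sub>R x)" for x :: 'a
    using c by (simp add: pweight_def ennreal_mult[symmetric] powr_mult powr_minus)
  have "(\<integral>\<^sup>+x. F (c *\<^sub>R x) * pweight \<theta> x \<partial>lborel)
      = ennreal (c powr - \<theta>) * (\<integral>\<^sup>+x. F (c *\<^sub>R x) * pweight \<theta> (c *\<^sub>R x) \<partial>lborel)"
    by (subst w) (simp add: nn_integral_cmult[symmetric] mult_ac)
  also have "\<dots> = ennreal (c powr (- (real DIM('a) + \<theta>))) * (ennreal (\<bar>c\<bar> ^ DIM('a)) * (\<integral>\<^sup>+x. F (c *\<^sub>R x) * pweight \<theta> (c *\<^sub>R x) \<partial>lborel))"
    using c by (simp add: mult.assoc[symmetric] ennreal_mult[symmetric] powr_realpow[symmetric] powr_add[symmetric])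
  also have "\<dots> = ennreal (c powr (- (real DIM('a) + \<theta>))) * (\<integral>\<^sup>+x. F x * pweight \<theta> x \<partial>lborel)"
    using c by (subst nn_integral_lborel_dilate[of "\<lambda>x. F x * pweight \<theta> x" c]) auto
  finally show ?thesis .
qed

text \<open>At distance at least \<open>R\<close> from the origin a translation by at most \<open>2 * R\<close> enlarges the norm at most
three times, so the weight, a nonincreasing function of the norm, drops at most by the factor
\<open>3 powr \<theta>\<close>. Near the origin there is no such bound unless \<open>\<theta> = 0\<close>.\<close>

lemma nn_integral_translate_pweight_far:
  fixes F :: "'a::euclidean_space \<Rightarrow> ennreal"
  assumes [measurable]: "F \<in> borel_measurable borel" and R: "0 < R" and z: "norm z \<le> 2 * R" and \<theta>: "\<theta> \<le> 0"
  shows "(\<integral>\<^sup>+x. indicator {x. R \<le> norm x} x * (F (x + z) * pweight \<theta> x) \<partial>lborel)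
    \<le> ennreal (3 powr - \<theta>) * (\<integral>\<^sup>+x. F x * pweight \<theta> x \<partial>lborel)"
proof -
  have "(\<integral>\<^sup>+x. indicator {x. R \<le> norm x} x * (F (x + z) * pweight \<theta> x) \<partial>lborel)
      \<le> (\<integral>\<^sup>+x. ennreal (3 powr - \<theta>) * (F (x + z) * pweight \<theta> (x + z)) \<partial>lborel)"
  proof (rule nn_integral_mono_AE)
    \<comment> \<open>The point \<open>- z\<close> is excluded because it is moved to the origin, where \<open>pweight\<close> vanishes.\<close>
    have "indicator {x. R \<le> norm x} x * (F (x + z) * pweight \<theta> x)
      \<le> ennreal (3 powr - \<theta>) * (F (x + z) * pweight \<theta> (x + z))" if "x \<noteq> - z" for x
    proof (cases "R \<le> norm x")
      case True
      have "norm (x + z) \<le> norm x + norm z" by (rule norm_triangle_ineq)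
      then have "norm (x + z) / 3 \<le> norm x" using True z by simp
      moreover have "x + z \<noteq> 0" using that by (simp add: eq_neg_iff_add_eq_0)
      ultimately have "norm x powr \<theta> \<le> (norm (x + z) / 3) powr \<theta>"
        using \<theta> by (intro powr_mono2') auto
      also have "\<dots> = 3 powr - \<theta> * norm (x + z) powr \<theta>" by (simp add: powr_divide powr_minus_divide)
      finally have "pweight \<theta> x \<le> ennreal (3 powr - \<theta>) * pweight \<theta> (x + z)"
        by (simp add: pweight_def ennreal_mult[symmetric] ennreal_leI)
      then have "F (x + z) * pweight \<theta> x \<le> F (x + z) * (ennreal (3 powr - \<theta>) * pweight \<theta> (x + z))"
        by (intro mult_left_mono) auto
      then show ?thesis using True by (simp add: mult_ac)
    qed simp
    then show "AE x in lborel. indicator {x. R \<le> norm x} x * (F (x + z) * pweight \<theta> x)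
      \<le> ennreal (3 powr - \<theta>) * (F (x + z) * pweight \<theta> (x + z))"
      using AE_lborel_singleton[of "- z"] by auto
  qed
  also have "\<dots> = ennreal (3 powr - \<theta>) * (\<integral>\<^sup>+x. F x * pweight \<theta> x \<partial>lborel)"
    using nn_integral_lborel_translate[of "\<lambda>x. F x * pweight \<theta> x" z] by (simp add: nn_integral_cmult)
  finally show ?thesis .
qed

text \<open>Doubling maps the annulus between \<open>r\<close> and \<open>R\<close> to the annulus between \<open>2 * r\<close> and \<open>2 * R\<close>. By
homogeneity the mass of the first is at most \<open>q < 1\<close> times itself plus a term that does not depend
on \<open>r\<close>; so it stays bounded as \<open>r\<close> tends to \<open>0\<close>.\<close>

lemma pweight_locally_integrable:
  assumes \<theta>: "- real DIM('a) < \<theta>" "\<theta> \<le> 0" and R: "0 < R"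
  shows "(\<integral>\<^sup>+x. indicator (ball (0::'a::euclidean_space) R) x * pweight \<theta> x \<partial>lborel) < \<infinity>"
proof -
  define q where "q = 2 powr (- (real DIM('a) + \<theta>))"
  have q: "0 \<le> q" "q < 1" using \<theta> by (auto simp: q_def powr_less_one)
  define a where "a = (\<lambda>r s. \<integral>\<^sup>+x. indicator {x::'a. r \<le> norm x \<and> norm x < s} x * pweight \<theta> x \<partial>lborel)"
  have a_fin: "a r s < \<infinity>" if "0 < r" for r s
  proof -
    have "a r s \<le> (\<integral>\<^sup>+x. ennreal (r powr \<theta>) * indicator (ball (0::'a) s) x \<partial>lborel)"
      unfolding a_def using that \<theta>
      by (intro nn_integral_mono) (auto simp: indicator_def pweight_def intro!: ennreal_leI powr_mono2')
    also have "\<dots> = ennreal (r powr \<theta>) * emeasure lborel (ball (0::'a) s)"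
      by (simp add: nn_integral_cmult_indicator)
    also have "\<dots> < \<infinity>" using emeasure_bounded_finite[of "ball (0::'a) s"]
      by (simp add: ennreal_mult_less_top)
    finally show ?thesis .
  qed
  define B where "B = ennreal (1 / (1 - q)) * (ennreal q * a R (2 * R))"
  have a_le: "a r R \<le> B" if r: "0 < r" for r
  proof -
    have "a r R = (\<integral>\<^sup>+x. indicator {x::'a. 2 * r \<le> norm x \<and> norm x < 2 * R} (2 *\<^sub>R x) * pweight \<theta> x \<partial>lborel)"
      unfolding a_def by (intro nn_integral_cong) (auto simp: indicator_def)
    also have "\<dots> = ennreal q * a (2 * r) (2 * R)"
      unfolding a_def q_def by (rule nn_integral_dilate_pweight) auto
    also have "a (2 * r) (2 * R) \<le> a r R + a R (2 * R)"
      unfolding a_def using r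
      by (subst nn_integral_add[symmetric]) (auto intro!: nn_integral_mono simp: indicator_def)
    finally have "a r R \<le> ennreal q * a r R + ennreal q * a R (2 * R)"
      by (simp add: distrib_left mult_left_mono)
    then show ?thesis unfolding B_def using a_fin[OF r] q by (intro ennreal_absorb) auto
  qed
  have "(\<integral>\<^sup>+x. indicator (ball (0::'a) R) x * pweight \<theta> x \<partial>lborel)
      = (\<integral>\<^sup>+x. (SUP k. indicator {x::'a. 1 / real (Suc k) \<le> norm x \<and> norm x < R} x * pweight \<theta> x) \<partial>lborel)"
  proof (intro nn_integral_cong)
    fix x :: 'a
    show "indicator (ball 0 R) x * pweight \<theta> x
      = (SUP k. indicator {x. 1 / real (Suc k) \<le> norm x \<and> norm x < R} x * pweight \<theta> x)"
    proof (cases "x = 0 \<or> R \<le> norm x")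
      case True
      then show ?thesis by (auto simp: pweight_def indicator_def)
    next
      case False
      then obtain k where k: "1 / real (Suc k) < norm x"
        using reals_Archimedean[of "norm x"] by (auto simp: inverse_eq_divide)
      show ?thesis
      proof (rule antisym)
        show "indicator (ball 0 R) x * pweight \<theta> x \<le> (SUP k. indicator {x. 1 / real (Suc k) \<le> norm x \<and> norm x < R} x * pweight \<theta> x)"
          by (rule SUP_upper2[of k]) (use k in \<open>auto simp: indicator_def\<close>)
        show "(SUP k. indicator {x. 1 / real (Suc k) \<le> norm x \<and> norm x < R} x * pweight \<theta> x) \<le> indicator (ball 0 R) x * pweight \<theta> x"
          by (rule SUP_least) (auto simp: indicator_def)
      qed
    qed
  qed
  also have "\<dots> = (SUP k. a (1 / real (Suc k)) R)"
    unfolding a_def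
  proof (rule nn_integral_monotone_convergence_SUP)
    show "incseq (\<lambda>k x. indicator {x::'a. 1 / real (Suc k) \<le> norm x \<and> norm x < R} x * pweight \<theta> x)"
    proof (intro incseq_SucI le_funI)
      fix k and x :: 'a
      have "1 / real (Suc (Suc k)) \<le> 1 / real (Suc k)" by (simp add: field_simps)
      then show "indicator {x. 1 / real (Suc k) \<le> norm x \<and> norm x < R} x * pweight \<theta> x
        \<le> indicator {x. 1 / real (Suc (Suc k)) \<le> norm x \<and> norm x < R} x * pweight \<theta> x"
        by (auto simp: indicator_def)
    qed
  qed auto
  also have "\<dots> \<le> B" by (intro SUP_least a_le) auto
  also have "\<dots> < \<infinity>" using a_fin[OF R] by (simp add: B_def ennreal_mult_less_top)
  finally show ?thesis .
qed

text \<open>By Tonelli's theorem, a bound that is uniform in the parameter \<open>s\<close> of a family of segments passes to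
the average over \<open>s\<close>.\<close>

lemma nn_integral_swap_unit_interval_le:
  fixes H :: "real \<Rightarrow> 'a::euclidean_space \<Rightarrow> ennreal"
  assumes [measurable]: "case_prod H \<in> borel_measurable (borel \<Otimes>\<^sub>M borel)"
    and le: "\<And>s. 0 \<le> s \<Longrightarrow> s \<le> 1 \<Longrightarrow> (\<integral>\<^sup>+x. H s x \<partial>lborel) \<le> B"
  shows "(\<integral>\<^sup>+x. (\<integral>\<^sup>+s. indicator {0..1} s * H s x \<partial>lborel) \<partial>lborel) \<le> B"
proof -
  have "(\<integral>\<^sup>+x. (\<integral>\<^sup>+s. indicator {0..1} s * H s x \<partial>lborel) \<partial>lborel)
      = (\<integral>\<^sup>+s. (\<integral>\<^sup>+x. indicator {0..1} s * H s x \<partial>lborel) \<partial>lborel)"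
    by (rule lborel_pair.Fubini') measurable
  also have "\<dots> \<le> (\<integral>\<^sup>+s. B * indicator {0..1::real} s \<partial>lborel)"
    by (intro nn_integral_mono) (auto simp: indicator_def le)
  also have "\<dots> = B" by (simp add: nn_integral_cmult_indicator)
  finally show ?thesis .
qed

section \<open>Weighted energies near and away from the origin\<close>

text \<open>The \<open>p\<close>-th power of the weighted norm, written with the Lebesgue-Borel measure so that Tonelli's
theorem applies. It is split along the sphere of radius \<open>R\<close> around the origin: outside, translations
are harmless; inside, dilations are used.\<close>

definition energy :: "real \<Rightarrow> real \<Rightarrow> (real ^ 'n::finite \<Rightarrow> real) \<Rightarrow> ennreal" where
  "energy p \<theta> f = (\<integral>\<^sup>+x. ennreal (\<bar>f x\<bar> powr p) * pweight \<theta> x \<partial>lborel)"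

definition energy_far :: "real \<Rightarrow> real \<Rightarrow> real \<Rightarrow> (real ^ 'n::finite \<Rightarrow> real) \<Rightarrow> ennreal" where
  "energy_far p \<theta> R f = (\<integral>\<^sup>+x. indicator {x. R \<le> norm x} x * (ennreal (\<bar>f x\<bar> powr p) * pweight \<theta> x) \<partial>lborel)"

definition energy_near :: "real \<Rightarrow> real \<Rightarrow> real \<Rightarrow> (real ^ 'n::finite \<Rightarrow> real) \<Rightarrow> ennreal" where
  "energy_near p \<theta> R f = (\<integral>\<^sup>+x. indicator (ball 0 R) x * (ennreal (\<bar>f x\<bar> powr p) * pweight \<theta> x) \<partial>lborel)"

lemma energy_split:
  assumes [measurable]: "f \<in> borel_measurable borel"
  shows "energy p \<theta> f = energy_near p \<theta> R f + energy_far p \<theta> R f"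
  unfolding energy_def energy_near_def energy_far_def
  by (subst nn_integral_add[symmetric]) (auto intro!: nn_integral_cong simp: indicator_def)

lemma energy_near_finite:
  fixes f :: "real ^ 'n::finite \<Rightarrow> real"
  assumes \<theta>: "- real CARD('n) < \<theta>" "\<theta> \<le> 0" and p: "0 < p" and R: "0 < R" and f: "continuous_on UNIV f"
  shows "energy_near p \<theta> R f < \<infinity>"
proof -
  have "compact (f ` cball 0 R)"
    by (intro compact_continuous_image continuous_on_subset[OF f]) auto
  then obtain B where B: "\<And>x. x \<in> cball 0 R \<Longrightarrow> \<bar>f x\<bar> \<le> B"
    using compact_imp_bounded[of "f ` cball 0 R"] by (metis bounded_iff imageI real_norm_def)
  have "energy_near p \<theta> R f \<le> (\<integral>\<^sup>+x. ennreal (B powr p) * (indicator (ball (0::real^'n) R) x * pweight \<theta> x) \<partial>lborel)"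
    unfolding energy_near_def using B p
    by (intro nn_integral_mono) (auto simp: indicator_def intro!: mult_right_mono ennreal_leI powr_mono2)
  also have "\<dots> = ennreal (B powr p) * (\<integral>\<^sup>+x. indicator (ball (0::real^'n) R) x * pweight \<theta> x \<partial>lborel)"
    by (intro nn_integral_cmult borel_measurable_times_ennreal borel_measurable_indicator) auto
  also have "\<dots> < \<infinity>"
    using pweight_locally_integrable[where 'a = "real^'n", of \<theta> R] \<theta> R by (simp add: ennreal_mult_less_top)
  finally show ?thesis .
qed

section \<open>The ball around the origin\<close>

text \<open>A Hardy type inequality. Inside the ball of radius \<open>R\<close>, compare \<open>f x\<close> with \<open>f (2 * x)\<close>. The
difference is controlled by the gradient on the segment between the two points, multiplied by \<open>R\<close>.
The energy of the dilated function is the energy on the ball of radius \<open>2 * R\<close> times \<open>2 powr (- d)\<close>,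
where \<open>d > 0\<close> is the degree of homogeneity; the part of it inside the original ball is absorbed on
the left, and the other part belongs to the exterior. The gradient is integrated over dilated copies
\<open>(1 + s) * x\<close>, which again does not increase its energy.\<close>

lemma energy_near_le:
  fixes \<theta> p :: real
  assumes \<theta>: "- real CARD('n::finite) < \<theta>" "\<theta> \<le> 0" and p: "1 < p"
  shows "\<exists>C>0. \<forall>f::real^'n \<Rightarrow> real. \<forall>R>0. smooth f \<longrightarrow>
    energy_near p \<theta> R f \<le> ennreal C * (energy_far p \<theta> R f + ennreal (R powr p) * (\<Sum>i\<in>UNIV. energy p \<theta> (partial_deriv i f)))"
proof -
  define n where "n = real CARD('n)"
  define d where "d = n + \<theta>"
  have d: "0 < d" using \<theta> by (simp add: d_def n_def)
  \<comment> \<open>The dilation supplies the factor \<open>2 powr (- d)\<close>. Half of this gain is spent on the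
    constant \<open>(1 + \<tau>) powr p = 2 powr (d / 2)\<close>; the other half is the absorption factor
    \<open>q < 1\<close>.\<close>
  define q where "q = 2 powr (- (d / 2))"
  have q: "0 \<le> q" "q < 1" using d by (auto simp: q_def powr_less_one)
  define \<tau> where "\<tau> = 2 powr (d / (2 * p)) - 1"
  have \<tau>: "0 < \<tau>" using d p gr_one_powr[of 2 "d / (2 * p)"] by (simp add: \<tau>_def)
  have \<tau>q: "(1 + \<tau>) powr p * 2 powr - d = q"
    using p by (simp add: \<tau>_def q_def powr_powr powr_add[symmetric] field_simps)
  define K where "K = (1 + 1 / \<tau>) powr p * n powr p"
  have "0 < 1 + 1 / \<tau>" using \<tau> by (simp add: add_pos_pos)
  then have K: "0 < K" unfolding K_def n_def by (intro mult_pos_pos) (simp_all only: powr_gt_zero, simp_all)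
  show ?thesis
  proof (intro exI conjI allI impI)
    let ?C = "(1 / (1 - q)) * (q + K)"
    show "0 < ?C" using q K by (intro mult_pos_pos) auto
    fix f :: "real^'n \<Rightarrow> real" and R :: real
    assume R: "0 < R" and f: "smooth f"
    have [measurable]: "f \<in> borel_measurable borel" "partial_deriv i f \<in> borel_measurable borel" for i
      using f by (auto intro: smooth_borel_measurable smooth_partial_deriv)
    define G where "G = (\<lambda>y. \<Sum>i\<in>UNIV. ennreal (\<bar>partial_deriv i f y\<bar> powr p))"
    have [measurable]: "G \<in> borel_measurable borel" unfolding G_def by measurable
    let ?W = "pweight \<theta> :: real^'n \<Rightarrow> ennreal"
    let ?H = "\<lambda>s x. G ((1 + s) *\<^sub>R x) * ?W x"
    have E: "(\<integral>\<^sup>+x. G x * ?W x \<partial>lborel) = (\<Sum>i\<in>UNIV. energy p \<theta> (partial_deriv i f))"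
      by (simp add: G_def energy_def sum_distrib_right nn_integral_sum del: sum_ennreal)
    have ptw: "indicator (ball 0 R) x * (ennreal (\<bar>f x\<bar> powr p) * ?W x)
      \<le> ennreal ((1 + \<tau>) powr p) * (indicator (ball 0 (2 * R)) (2 *\<^sub>R x) * ennreal (\<bar>f (2 *\<^sub>R x)\<bar> powr p) * ?W x)
       + ennreal (K * R powr p) * (\<integral>\<^sup>+s. indicator {0..1} s * ?H s x \<partial>lborel)" for x
    proof (cases "x \<in> ball 0 R")
      case True
      then have xR: "norm x < R" by simp
      define g where "g = (\<lambda>s. f (x + s *\<^sub>R x))"
      define g' where "g' = (\<lambda>s. \<Sum>i\<in>UNIV. x $ i * partial_deriv i f (x + s *\<^sub>R x))"
      have g: "(g has_real_derivative g' s) (at s)" for s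
        unfolding g_def g'_def by (rule has_real_derivative_along_line[OF f])
      have cont: "continuous_on UNIV g'"
        unfolding g'_def
        by (intro continuous_intros continuous_on_compose2[OF smooth_continuous_on[OF smooth_partial_deriv[OF f], of UNIV]]) auto
      have g'_le: "ennreal (\<bar>g' s\<bar> powr p) \<le> ennreal (n powr p * R powr p) * G ((1 + s) *\<^sub>R x)" for s
      proof -
        have "\<bar>g' s\<bar> \<le> (\<Sum>i\<in>UNIV. R * \<bar>partial_deriv i f (x + s *\<^sub>R x)\<bar>)"
          unfolding g'_def
        proof (rule order_trans[OF sum_abs], rule sum_mono)
          fix i
          have "\<bar>x $ i\<bar> \<le> R" using component_le_norm_cart[of x i] xR by linarith
          then show "\<bar>x $ i * partial_deriv i f (x + s *\<^sub>R x)\<bar> \<le> R * \<bar>partial_deriv i f (x + s *\<^sub>R x)\<bar>"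
            by (simp add: abs_mult mult_right_mono)
        qed
        then have "\<bar>g' s\<bar> powr p \<le> (\<Sum>i\<in>UNIV. R * \<bar>partial_deriv i f (x + s *\<^sub>R x)\<bar>) powr p"
          using p by (intro powr_mono2) auto
        also have "\<dots> \<le> real CARD('n) powr p * (\<Sum>i\<in>UNIV. (R * \<bar>partial_deriv i f (x + s *\<^sub>R x)\<bar>) powr p)"
          using p R by (intro powr_sum_le) auto
        also have "\<dots> = n powr p * R powr p * (\<Sum>i\<in>UNIV. \<bar>partial_deriv i f (x + s *\<^sub>R x)\<bar> powr p)"
          using R by (simp add: n_def powr_mult sum_distrib_left mult.assoc)
        finally have "ennreal (\<bar>g' s\<bar> powr p) \<le> ennreal (n powr p * R powr p * (\<Sum>i\<in>UNIV. \<bar>partial_deriv i f (x + s *\<^sub>R x)\<bar> powr p))"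
          by (rule ennreal_leI)
        also have "\<dots> = ennreal (n powr p * R powr p) * G (x + s *\<^sub>R x)"
          by (simp add: G_def ennreal_mult sum_nonneg)
        finally show ?thesis by (simp add: scaleR_add_left)
      qed
      have "\<bar>f x\<bar> powr p \<le> (\<bar>f (2 *\<^sub>R x)\<bar> + \<bar>f (2 *\<^sub>R x) - f x\<bar>) powr p"
        using p by (intro powr_mono2) auto
      also have "\<dots> \<le> (1 + \<tau>) powr p * \<bar>f (2 *\<^sub>R x)\<bar> powr p + (1 + 1/\<tau>) powr p * \<bar>f (2 *\<^sub>R x) - f x\<bar> powr p"
        using \<tau> p by (intro powr_add_le_weighted) auto
      finally have "ennreal (\<bar>f x\<bar> powr p) \<le> ennreal ((1 + \<tau>) powr p) * ennreal (\<bar>f (2 *\<^sub>R x)\<bar> powr p)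
          + ennreal ((1 + 1/\<tau>) powr p) * ennreal (\<bar>f (2 *\<^sub>R x) - f x\<bar> powr p)"
        by (simp add: ennreal_mult[symmetric] ennreal_plus[symmetric] ennreal_leI del: ennreal_plus)
      also have "ennreal (\<bar>f (2 *\<^sub>R x) - f x\<bar> powr p) = ennreal (\<bar>g 1 - g 0\<bar> powr p)"
        by (simp add: g_def scaleR_2)
      also have "\<dots> \<le> (\<integral>\<^sup>+s. indicator {0..1} s * ennreal (\<bar>g' s\<bar> powr p) \<partial>lborel)"
        by (rule increment_powr_le_nn_integral[OF p _ _ g cont]) auto
      also have "\<dots> \<le> (\<integral>\<^sup>+s. ennreal (n powr p * R powr p) * (indicator {0..1} s * G ((1 + s) *\<^sub>R x)) \<partial>lborel)"
        using g'_le by (intro nn_integral_mono) (auto simp: indicator_def)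
      also have "\<dots> = ennreal (n powr p * R powr p) * (\<integral>\<^sup>+s. indicator {0..1} s * G ((1 + s) *\<^sub>R x) \<partial>lborel)"
        by (intro nn_integral_cmult) measurable
      finally have "ennreal (\<bar>f x\<bar> powr p) \<le> ennreal ((1 + \<tau>) powr p) * ennreal (\<bar>f (2 *\<^sub>R x)\<bar> powr p)
          + ennreal (K * R powr p) * (\<integral>\<^sup>+s. indicator {0..1} s * G ((1 + s) *\<^sub>R x) \<partial>lborel)"
        using \<tau> by (simp add: K_def ennreal_mult mult.assoc add_left_mono mult_left_mono)
      then have "ennreal (\<bar>f x\<bar> powr p) * ?W x \<le> (ennreal ((1 + \<tau>) powr p) * ennreal (\<bar>f (2 *\<^sub>R x)\<bar> powr p)
          + ennreal (K * R powr p) * (\<integral>\<^sup>+s. indicator {0..1} s * G ((1 + s) *\<^sub>R x) \<partial>lborel)) * ?W x"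
        by (rule mult_right_mono) simp
      also have "\<dots> = ennreal ((1 + \<tau>) powr p) * (ennreal (\<bar>f (2 *\<^sub>R x)\<bar> powr p) * ?W x)
          + ennreal (K * R powr p) * (\<integral>\<^sup>+s. indicator {0..1} s * ?H s x \<partial>lborel)"
        by (simp add: distrib_right mult.assoc nn_integral_multc[symmetric])
      finally show ?thesis using xR by simp
    qed simp
    have [measurable]: "(indicator (ball 0 r) :: real^'n \<Rightarrow> ennreal) \<in> borel_measurable borel" for r
      by (intro borel_measurable_indicator) auto
    have dil: "(\<integral>\<^sup>+x. indicator (ball 0 (2 * R)) (2 *\<^sub>R x) * ennreal (\<bar>f (2 *\<^sub>R x)\<bar> powr p) * ?W x \<partial>lborel)
        = ennreal (2 powr - d) * energy_near p \<theta> (2 * R) f"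
      unfolding energy_near_def d_def n_def
      using nn_integral_dilate_pweight[of "\<lambda>y::real^'n. indicator (ball 0 (2 * R)) y * ennreal (\<bar>f y\<bar> powr p)" 2 \<theta>]
      by (simp add: mult.assoc)
    have near2: "energy_near p \<theta> (2 * R) f \<le> energy_near p \<theta> R f + energy_far p \<theta> R f"
      unfolding energy_near_def energy_far_def
      by (subst nn_integral_add[symmetric]) (auto intro!: nn_integral_mono simp: indicator_def)
    have seg: "(\<integral>\<^sup>+x. (\<integral>\<^sup>+s. indicator {0..1} s * ?H s x \<partial>lborel) \<partial>lborel) \<le> (\<Sum>i\<in>UNIV. energy p \<theta> (partial_deriv i f))"
    proof (rule nn_integral_swap_unit_interval_le)
      fix s :: real assume s: "0 \<le> s" "s \<le> 1"
      have "(\<integral>\<^sup>+x. ?H s x \<partial>lborel) = ennreal ((1 + s) powr - d) * (\<integral>\<^sup>+x. G x * ?W x \<partial>lborel)"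
        unfolding d_def n_def using s nn_integral_dilate_pweight[of G "1 + s" \<theta>] by simp
      also have "\<dots> \<le> 1 * (\<integral>\<^sup>+x. G x * ?W x \<partial>lborel)"
        using s d powr_mono[of "- d" 0 "1 + s"] by (intro mult_right_mono) (auto simp: ennreal_le_1)
      finally show "(\<integral>\<^sup>+x. ?H s x \<partial>lborel) \<le> (\<Sum>i\<in>UNIV. energy p \<theta> (partial_deriv i f))"
        by (simp add: E)
    qed measurable
    have "energy_near p \<theta> R f \<le> (\<integral>\<^sup>+x. ennreal ((1 + \<tau>) powr p) * (indicator (ball 0 (2 * R)) (2 *\<^sub>R x) * ennreal (\<bar>f (2 *\<^sub>R x)\<bar> powr p) * ?W x)
       + ennreal (K * R powr p) * (\<integral>\<^sup>+s. indicator {0..1} s * ?H s x \<partial>lborel) \<partial>lborel)"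
      unfolding energy_near_def by (intro nn_integral_mono ptw)
    also have "\<dots> = ennreal ((1 + \<tau>) powr p) * (ennreal (2 powr - d) * energy_near p \<theta> (2 * R) f)
       + ennreal (K * R powr p) * (\<integral>\<^sup>+x. (\<integral>\<^sup>+s. indicator {0..1} s * ?H s x \<partial>lborel) \<partial>lborel)"
      by (subst nn_integral_add) (simp_all add: nn_integral_cmult dil)
    also have "\<dots> \<le> ennreal ((1 + \<tau>) powr p) * (ennreal (2 powr - d) * (energy_near p \<theta> R f + energy_far p \<theta> R f))
       + ennreal (K * R powr p) * (\<Sum>i\<in>UNIV. energy p \<theta> (partial_deriv i f))"
      by (intro add_mono mult_left_mono near2 seg) auto
    also have "\<dots> = ennreal q * energy_near p \<theta> R f + (ennreal q * energy_far p \<theta> R f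
       + ennreal (K * R powr p) * (\<Sum>i\<in>UNIV. energy p \<theta> (partial_deriv i f)))"
      by (simp add: mult.assoc[symmetric] ennreal_mult[symmetric] \<tau>q distrib_left add.assoc)
    finally have "energy_near p \<theta> R f \<le> ennreal (1 / (1 - q)) * (ennreal q * energy_far p \<theta> R f
       + ennreal (K * R powr p) * (\<Sum>i\<in>UNIV. energy p \<theta> (partial_deriv i f)))"
      using q p R f \<theta> by (intro ennreal_absorb energy_near_finite smooth_continuous_on) auto
    also have "\<dots> \<le> ennreal (1 / (1 - q)) * (ennreal (q + K) * energy_far p \<theta> R f
       + ennreal (q + K) * (ennreal (R powr p) * (\<Sum>i\<in>UNIV. energy p \<theta> (partial_deriv i f))))"
      using q K by (intro mult_left_mono add_mono) (auto simp: ennreal_mult mult.assoc[symmetric] intro!: mult_right_mono ennreal_leI)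
    also have "\<dots> = ennreal ?C * (energy_far p \<theta> R f + ennreal (R powr p) * (\<Sum>i\<in>UNIV. energy p \<theta> (partial_deriv i f)))"
    proof -
      have "ennreal ?C = ennreal (1 / (1 - q)) * ennreal (q + K)"
        using q K by (intro ennreal_mult) auto
      then show ?thesis by (simp only: distrib_left mult.assoc)
    qed
    finally show "energy_near p \<theta> R f \<le> ennreal ?C * (energy_far p \<theta> R f + ennreal (R powr p) * (\<Sum>i\<in>UNIV. energy p \<theta> (partial_deriv i f)))" .
  qed
qed

section \<open>Poincare and interpolation inequalities of first order\<close>

lemma norm_axis: "norm (axis i (h::real)) = \<bar>h\<bar>"
proof -
  have "axis i h = h *\<^sub>R axis i (1::real)" by (simp add: axis_def vec_eq_iff)
  then show ?thesis by simp
qed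

text \<open>Away from the origin the average over segments in a coordinate direction is bounded by the average
over translations.\<close>

lemma nn_integral_segment_far_le:
  fixes F :: "real ^ 'n::finite \<Rightarrow> ennreal"
  assumes [measurable]: "F \<in> borel_measurable borel" and R: "0 < R" and h: "\<bar>h\<bar> \<le> 2 * R" and \<theta>: "\<theta> \<le> 0"
  shows "(\<integral>\<^sup>+x. indicator {x. R \<le> norm x} x * ((\<integral>\<^sup>+s. indicator {0..1} s * F (x + s *\<^sub>R axis i h) \<partial>lborel) * pweight \<theta> x) \<partial>lborel)
    \<le> ennreal (3 powr - \<theta>) * (\<integral>\<^sup>+x. F x * pweight \<theta> x \<partial>lborel)"
proof -
  let ?H = "\<lambda>s x. indicator {x. R \<le> norm x} x * (F (x + s *\<^sub>R axis i h) * pweight \<theta> x)"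
  have "(\<integral>\<^sup>+x. indicator {x. R \<le> norm x} x * ((\<integral>\<^sup>+s. indicator {0..1} s * F (x + s *\<^sub>R axis i h) \<partial>lborel) * pweight \<theta> x) \<partial>lborel)
     = (\<integral>\<^sup>+x. (\<integral>\<^sup>+s. indicator {0..1} s * ?H s x \<partial>lborel) \<partial>lborel)"
    by (intro nn_integral_cong) (auto simp: indicator_def nn_integral_multc[symmetric] mult.assoc)
  also have "\<dots> \<le> ennreal (3 powr - \<theta>) * (\<integral>\<^sup>+x. F x * pweight \<theta> x \<partial>lborel)"
  proof (rule nn_integral_swap_unit_interval_le)
    fix s :: real assume s: "0 \<le> s" "s \<le> 1"
    have "norm (s *\<^sub>R axis i h) \<le> 2 * R"
      using s h mult_mono[of s 1 "\<bar>h\<bar>" "\<bar>h\<bar>"] by (simp add: norm_axis)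
    then show "(\<integral>\<^sup>+x. ?H s x \<partial>lborel) \<le> ennreal (3 powr - \<theta>) * (\<integral>\<^sup>+x. F x * pweight \<theta> x \<partial>lborel)"
      using R \<theta> by (intro nn_integral_translate_pweight_far) auto
  qed measurable
  finally show ?thesis .
qed

text \<open>For \<open>\<bar>x\<bar> \<ge> \<delta>\<close>, a segment of length \<open>2 * \<delta>\<close> in a coordinate direction leads out of the support, and
it is short enough for the translation estimate. The ball \<open>\<bar>x\<bar> < \<delta>\<close> is left to the Hardy type
inequality.\<close>

lemma poincare_first_order:
  fixes \<theta> p :: real
  assumes \<theta>: "- real CARD('n::finite) < \<theta>" "\<theta> \<le> 0" and p: "1 < p"
  shows "\<exists>C>0. \<forall>\<delta>>0. \<forall>x\<^sub>0. \<forall>f\<in>test_functions (ball (x\<^sub>0::real^'n) \<delta>).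
    energy p \<theta> f \<le> ennreal (C * \<delta> powr p) * (\<Sum>i\<in>UNIV. energy p \<theta> (partial_deriv i f))"
proof -
  obtain C where C: "0 < C" "\<And>(f::real^'n \<Rightarrow> real) R. 0 < R \<Longrightarrow> smooth f \<Longrightarrow>
    energy_near p \<theta> R f \<le> ennreal C * (energy_far p \<theta> R f + ennreal (R powr p) * (\<Sum>i\<in>UNIV. energy p \<theta> (partial_deriv i f)))"
    using energy_near_le[OF assms] by blast
  define K where "K = 2 powr p * 3 powr - \<theta>"
  have K: "0 < K" by (simp add: K_def)
  show ?thesis
  proof (intro exI conjI allI impI ballI)
    let ?C = "K + C * (K + 1)"
    show "0 < ?C" using K C by (simp add: add_pos_pos)
    fix \<delta> :: real and x0 and f :: "real^'n \<Rightarrow> real"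
    assume \<delta>: "0 < \<delta>" and ft: "f \<in> test_functions (ball x0 \<delta>)"
    then have f: "smooth f" by (simp add: test_functions_def)
    note [measurable] = smooth_borel_measurable[OF f] smooth_borel_measurable[OF smooth_partial_deriv[OF f]]
    \<comment> \<open>Any coordinate direction leads out of the ball.\<close>
    define i :: 'n where "i = undefined"
    let ?S = "\<Sum>i\<in>UNIV. energy p \<theta> (partial_deriv i f)"
    have f0: "f x = 0" if "x \<notin> ball x0 \<delta>" for x
      using ft that closure_subset[of "{x. f x \<noteq> 0}"] by (auto simp: test_functions_def)
    let ?F = "\<lambda>y. ennreal (\<bar>partial_deriv i f y\<bar> powr p)"
    have ptw: "ennreal (\<bar>f x\<bar> powr p) \<le> ennreal ((2 * \<delta>) powr p) * (\<integral>\<^sup>+s. indicator {0..1} s * ?F (x + s *\<^sub>R axis i (2 * \<delta>)) \<partial>lborel)" for x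
    proof (cases "x \<in> ball x0 \<delta>")
      case True
      define g where "g = (\<lambda>s. f (x + s *\<^sub>R axis i (2 * \<delta>)))"
      define g' where "g' = (\<lambda>s. 2 * \<delta> * partial_deriv i f (x + s *\<^sub>R axis i (2 * \<delta>)))"
      have g: "(g has_real_derivative g' s) (at s)" for s
        unfolding g_def g'_def by (rule has_real_derivative_along_axis[OF f])
      have cont: "continuous_on UNIV g'"
        unfolding g'_def
        by (intro continuous_intros continuous_on_compose2[OF smooth_continuous_on[OF smooth_partial_deriv[OF f], of UNIV]]) auto
      have "x + axis i (2 * \<delta>) \<notin> ball x0 \<delta>"
      proof
        assume "x + axis i (2 * \<delta>) \<in> ball x0 \<delta>"
        then have "dist x (x + axis i (2 * \<delta>)) < 2 * \<delta>"
          using True dist_triangle_less_add[of x x0 \<delta> "x + axis i (2 * \<delta>)" \<delta>] by (simp add: dist_commute)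
        then show False using \<delta> by (simp add: dist_norm norm_axis)
      qed
      then have "g 1 = 0" by (simp add: g_def f0)
      then have "ennreal (\<bar>f x\<bar> powr p) = ennreal (\<bar>g 1 - g 0\<bar> powr p)" by (simp add: g_def)
      also have "\<dots> \<le> (\<integral>\<^sup>+s. indicator {0..1} s * ennreal (\<bar>g' s\<bar> powr p) \<partial>lborel)"
        by (rule increment_powr_le_nn_integral[OF p _ _ g cont]) auto
      also have "\<dots> = (\<integral>\<^sup>+s. ennreal ((2 * \<delta>) powr p) * (indicator {0..1} s * ?F (x + s *\<^sub>R axis i (2 * \<delta>))) \<partial>lborel)"
        using \<delta> by (intro nn_integral_cong) (simp add: g'_def abs_mult powr_mult ennreal_mult mult_ac)
      also have "\<dots> = ennreal ((2 * \<delta>) powr p) * (\<integral>\<^sup>+s. indicator {0..1} s * ?F (x + s *\<^sub>R axis i (2 * \<delta>)) \<partial>lborel)"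
        by (intro nn_integral_cmult) measurable
      finally show ?thesis .
    qed (use p in \<open>simp add: f0\<close>)
    have "energy_far p \<theta> \<delta> f \<le> (\<integral>\<^sup>+x. ennreal ((2 * \<delta>) powr p) * (indicator {x. \<delta> \<le> norm x} x *
       ((\<integral>\<^sup>+s. indicator {0..1} s * ?F (x + s *\<^sub>R axis i (2 * \<delta>)) \<partial>lborel) * pweight \<theta> x)) \<partial>lborel)"
      unfolding energy_far_def
      using mult_right_mono[OF ptw] by (intro nn_integral_mono) (auto simp: indicator_def mult.assoc)
    also have "\<dots> = ennreal ((2 * \<delta>) powr p) * (\<integral>\<^sup>+x. indicator {x. \<delta> \<le> norm x} x *
       ((\<integral>\<^sup>+s. indicator {0..1} s * ?F (x + s *\<^sub>R axis i (2 * \<delta>)) \<partial>lborel) * pweight \<theta> x) \<partial>lborel)"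
      by (intro nn_integral_cmult) measurable
    also have "\<dots> \<le> ennreal ((2 * \<delta>) powr p) * (ennreal (3 powr - \<theta>) * energy p \<theta> (partial_deriv i f))"
      unfolding energy_def using \<delta> \<theta>
      by (intro mult_left_mono nn_integral_segment_far_le) auto
    also have "\<dots> = ennreal (K * \<delta> powr p) * energy p \<theta> (partial_deriv i f)"
      using \<delta> by (simp add: K_def powr_mult mult.assoc[symmetric] ennreal_mult[symmetric]) (simp add: mult_ac)
    also have "\<dots> \<le> ennreal (K * \<delta> powr p) * ?S"
      by (intro mult_left_mono member_le_sum) auto
    finally have far: "energy_far p \<theta> \<delta> f \<le> ennreal (K * \<delta> powr p) * ?S" .
    have "energy p \<theta> f = energy_near p \<theta> \<delta> f + energy_far p \<theta> \<delta> f"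
      by (rule energy_split) measurable
    also have "\<dots> \<le> ennreal C * (ennreal (K * \<delta> powr p) * ?S + ennreal (\<delta> powr p) * ?S) + ennreal (K * \<delta> powr p) * ?S"
      by (intro add_mono order_trans[OF C(2)[OF \<delta> f]] mult_left_mono far) auto
    also have "\<dots> = ennreal (?C * \<delta> powr p) * ?S"
      using C K by (simp add: mult.assoc[symmetric] ennreal_mult[symmetric] distrib_right[symmetric] ennreal_plus[symmetric] del: ennreal_plus)
        (simp add: algebra_simps)
    finally show "energy p \<theta> f \<le> ennreal (?C * \<delta> powr p) * ?S" .
  qed
qed

text \<open>The same division: for \<open>\<bar>x\<bar> \<ge> \<delta>\<close> the one-dimensional interpolation is used on segments of length \<open>\<delta>\<close>
in direction \<open>i\<close>; for \<open>\<bar>x\<bar> < \<delta>\<close> the Hardy type inequality is applied to the function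
\<open>partial_deriv i f\<close>, whose gradient consists of second derivatives of \<open>f\<close>.\<close>

lemma interpolation_first_order:
  fixes \<theta> p :: real
  assumes \<theta>: "- real CARD('n::finite) < \<theta>" "\<theta> \<le> 0" and p: "1 < p"
  shows "\<exists>C>0. \<forall>\<delta>>0. \<forall>f::real^'n \<Rightarrow> real. \<forall>i. smooth f \<longrightarrow>
    energy p \<theta> (partial_deriv i f) \<le> ennreal C * (ennreal (\<delta> powr - p) * energy p \<theta> f
      + ennreal (\<delta> powr p) * (\<Sum>j\<in>UNIV. energy p \<theta> (partial_deriv j (partial_deriv i f))))"
proof -
  obtain C where C: "0 < C" "\<And>(f::real^'n \<Rightarrow> real) R. 0 < R \<Longrightarrow> smooth f \<Longrightarrow>
    energy_near p \<theta> R f \<le> ennreal C * (energy_far p \<theta> R f + ennreal (R powr p) * (\<Sum>i\<in>UNIV. energy p \<theta> (partial_deriv i f)))"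
    using energy_near_le[OF assms] by blast
  define T where "T = 3 powr - \<theta>"
  have T: "0 < T" by (simp add: T_def)
  define K where "K = 3 powr p * (1 + T)"
  have K: "0 < K" using T by (simp add: K_def)
  show ?thesis
  proof (intro exI conjI allI impI)
    let ?C = "K + C * (K + 1)"
    show "0 < ?C" using K C by (simp add: add_pos_pos)
    fix \<delta> :: real and f :: "real^'n \<Rightarrow> real" and i :: 'n
    assume \<delta>: "0 < \<delta>" and f: "smooth f"
    note f' = smooth_partial_deriv[OF f, of i]
    note f'' = smooth_partial_deriv[OF f', of i]
    note [measurable] = smooth_borel_measurable[OF f] smooth_borel_measurable[OF f'] smooth_borel_measurable[OF f'']
    let ?v = "partial_deriv i f"
    let ?S = "\<Sum>j\<in>UNIV. energy p \<theta> (partial_deriv j ?v)"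
    let ?X = "ennreal (\<delta> powr - p) * energy p \<theta> f + ennreal (\<delta> powr p) * ?S"
    let ?I = "\<lambda>x. \<integral>\<^sup>+s. indicator {0..1} s * ennreal (\<bar>partial_deriv i ?v (x + s *\<^sub>R axis i \<delta>)\<bar> powr p) \<partial>lborel"
    have ptw: "ennreal (\<bar>?v x\<bar> powr p) \<le> ennreal (3 powr p) * (ennreal (\<delta> powr - p) * ennreal (\<bar>f (x + axis i \<delta>)\<bar> powr p)
        + ennreal (\<delta> powr - p) * ennreal (\<bar>f x\<bar> powr p) + ennreal (\<delta> powr p) * ?I x)" for x
    proof -
      define g where "g = (\<lambda>s. f (x + s *\<^sub>R axis i \<delta>))"
      define g' where "g' = (\<lambda>s. \<delta> * ?v (x + s *\<^sub>R axis i \<delta>))"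
      define g'' where "g'' = (\<lambda>s. \<delta> * (\<delta> * partial_deriv i ?v (x + s *\<^sub>R axis i \<delta>)))"
      have g: "(g has_real_derivative g' s) (at s)" for s
        unfolding g_def g'_def by (rule has_real_derivative_along_axis[OF f])
      have g': "(g' has_real_derivative g'' s) (at s)" for s
        unfolding g'_def g''_def by (intro DERIV_cmult has_real_derivative_along_axis[OF f'])
      have cont: "continuous_on UNIV g''"
        unfolding g''_def
        by (intro continuous_intros continuous_on_compose2[OF smooth_continuous_on[OF f'', of UNIV]]) auto
      have \<delta>p: "\<bar>\<delta> * y\<bar> powr p = \<delta> powr p * \<bar>y\<bar> powr p" for y
        using \<delta> by (simp add: abs_mult powr_mult)
      have "(\<integral>\<^sup>+s. indicator {0..1} s * ennreal (\<bar>g'' s\<bar> powr p) \<partial>lborel)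
          = (\<integral>\<^sup>+s. ennreal (\<delta> powr p * \<delta> powr p) * (indicator {0..1} s * ennreal (\<bar>partial_deriv i ?v (x + s *\<^sub>R axis i \<delta>)\<bar> powr p)) \<partial>lborel)"
        unfolding g''_def \<delta>p by (intro nn_integral_cong) (simp add: ennreal_mult mult_ac)
      also have "\<dots> = ennreal (\<delta> powr p * \<delta> powr p) * ?I x"
        by (intro nn_integral_cmult) measurable
      finally have I: "(\<integral>\<^sup>+s. indicator {0..1} s * ennreal (\<bar>g'' s\<bar> powr p) \<partial>lborel) = ennreal (\<delta> powr p * \<delta> powr p) * ?I x" .
      have one: "ennreal (\<delta> powr - p) * ennreal (\<delta> powr p) = 1"
        using \<delta> by (simp add: ennreal_mult[symmetric] powr_add[symmetric])
      have "ennreal (\<bar>?v x\<bar> powr p) = ennreal (\<delta> powr - p) * ennreal (\<delta> powr p) * ennreal (\<bar>?v x\<bar> powr p)"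
        by (simp add: one)
      also have "\<dots> = ennreal (\<delta> powr - p) * ennreal (\<bar>g' 0\<bar> powr p)"
        by (simp add: g'_def \<delta>p ennreal_mult mult.assoc)
      also have "\<dots> \<le> ennreal (\<delta> powr - p) * (ennreal (3 powr p) * (ennreal (\<bar>g 1\<bar> powr p) + ennreal (\<bar>g 0\<bar> powr p) + ennreal (\<delta> powr p * \<delta> powr p) * ?I x))"
        using derivative_powr_le_nn_integral[OF p g g' cont] unfolding I by (rule mult_left_mono) simp
      also have "\<dots> = ennreal (3 powr p) * (ennreal (\<delta> powr - p) * ennreal (\<bar>g 1\<bar> powr p)
        + ennreal (\<delta> powr - p) * ennreal (\<bar>g 0\<bar> powr p) + (ennreal (\<delta> powr - p) * ennreal (\<delta> powr p)) * (ennreal (\<delta> powr p) * ?I x))"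
        by (simp add: ennreal_mult distrib_left mult_ac)
      finally show ?thesis by (simp add: one g_def)
    qed
    let ?ind = "\<lambda>x::real^'n. indicator {x. \<delta> \<le> norm x} x :: ennreal"
    have "energy_far p \<theta> \<delta> ?v \<le> (\<integral>\<^sup>+x. ?ind x * (ennreal (3 powr p) * (ennreal (\<delta> powr - p) * ennreal (\<bar>f (x + axis i \<delta>)\<bar> powr p)
        + ennreal (\<delta> powr - p) * ennreal (\<bar>f x\<bar> powr p) + ennreal (\<delta> powr p) * ?I x) * pweight \<theta> x) \<partial>lborel)"
      unfolding energy_far_def by (intro nn_integral_mono mult_left_mono mult_right_mono ptw) auto
    also have "\<dots> = (\<integral>\<^sup>+x. ennreal (3 powr p * \<delta> powr - p) * (?ind x * (ennreal (\<bar>f (x + axis i \<delta>)\<bar> powr p) * pweight \<theta> x))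
        + (ennreal (3 powr p * \<delta> powr - p) * (?ind x * (ennreal (\<bar>f x\<bar> powr p) * pweight \<theta> x))
        + ennreal (3 powr p * \<delta> powr p) * (?ind x * (?I x * pweight \<theta> x))) \<partial>lborel)"
      by (intro nn_integral_cong) (simp add: ennreal_mult algebra_simps)
    also have "\<dots> = ennreal (3 powr p * \<delta> powr - p) * (\<integral>\<^sup>+x. ?ind x * (ennreal (\<bar>f (x + axis i \<delta>)\<bar> powr p) * pweight \<theta> x) \<partial>lborel)
        + (ennreal (3 powr p * \<delta> powr - p) * (\<integral>\<^sup>+x. ?ind x * (ennreal (\<bar>f x\<bar> powr p) * pweight \<theta> x) \<partial>lborel)
        + ennreal (3 powr p * \<delta> powr p) * (\<integral>\<^sup>+x. ?ind x * (?I x * pweight \<theta> x) \<partial>lborel))"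
      by (simp add: nn_integral_add nn_integral_cmult)
    also have "\<dots> \<le> ennreal (3 powr p * \<delta> powr - p) * (ennreal T * energy p \<theta> f)
        + (ennreal (3 powr p * \<delta> powr - p) * energy p \<theta> f + ennreal (3 powr p * \<delta> powr p) * (ennreal T * energy p \<theta> (partial_deriv i ?v)))"
    proof (intro add_mono mult_left_mono)
      show "(\<integral>\<^sup>+x. ?ind x * (ennreal (\<bar>f (x + axis i \<delta>)\<bar> powr p) * pweight \<theta> x) \<partial>lborel) \<le> ennreal T * energy p \<theta> f"
        unfolding energy_def T_def using \<delta> \<theta> by (intro nn_integral_translate_pweight_far) (auto simp: norm_axis)
      show "(\<integral>\<^sup>+x. ?ind x * (ennreal (\<bar>f x\<bar> powr p) * pweight \<theta> x) \<partial>lborel) \<le> energy p \<theta> f"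
        unfolding energy_def by (intro nn_integral_mono) (auto simp: indicator_def)
      show "(\<integral>\<^sup>+x. ?ind x * (?I x * pweight \<theta> x) \<partial>lborel) \<le> ennreal T * energy p \<theta> (partial_deriv i ?v)"
        unfolding energy_def T_def using \<delta> \<theta> by (intro nn_integral_segment_far_le) auto
    qed auto
    also have "\<dots> \<le> ennreal (3 powr p * \<delta> powr - p) * (ennreal T * energy p \<theta> f)
        + (ennreal (3 powr p * \<delta> powr - p) * energy p \<theta> f + ennreal (3 powr p * \<delta> powr p) * (ennreal (1 + T) * ?S))"
      using T by (intro add_mono mult_left_mono mult_mono member_le_sum ennreal_leI order_refl) auto
    also have "\<dots> = ennreal K * ?X"
      using T by (simp add: K_def ennreal_mult algebra_simps)
    finally have far: "energy_far p \<theta> \<delta> ?v \<le> ennreal K * ?X" .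
    have S: "ennreal (\<delta> powr p) * ?S \<le> ?X" by simp
    have "energy p \<theta> ?v = energy_near p \<theta> \<delta> ?v + energy_far p \<theta> \<delta> ?v"
      by (rule energy_split) measurable
    also have "\<dots> \<le> ennreal C * (ennreal K * ?X + ?X) + ennreal K * ?X"
      by (intro add_mono order_trans[OF C(2)[OF \<delta> f']] mult_left_mono far S) auto
    also have "\<dots> = ennreal ?C * ?X"
    proof -
      have "ennreal C * (ennreal K * X + X) + ennreal K * X = ennreal ?C * X" for X :: ennreal
        using C K by (simp add: ennreal_mult algebra_simps)
      then show ?thesis .
    qed
    finally show "energy p \<theta> ?v \<le> ennreal ?C * ?X" .
  qed
qed

section \<open>Poincare and interpolation inequalities of higher order\<close>

lemma ennreal_le_mult_of_ge_1: "1 \<le> c \<Longrightarrow> x \<le> ennreal c * x"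
  using mult_right_mono[of 1 "ennreal c" x] by simp

lemma finite_lists_of_length: "finite {is :: 'i::finite list. length is = k}"
  using finite_lists_length_eq[of "UNIV :: 'i set" k] by simp

lemma sum_lists_Suc:
  fixes F :: "'i::finite list \<Rightarrow> 'b::comm_monoid_add"
  shows "(\<Sum>is | length is = Suc k. F is) = (\<Sum>is | length is = k. \<Sum>i\<in>UNIV. F (i # is))"
proof -
  have "(\<Sum>is | length is = k. \<Sum>i\<in>UNIV. F (i # is)) = (\<Sum>(is, i)\<in>{is. length is = k} \<times> UNIV. F (i # is))"
    by (simp add: sum.cartesian_product)
  also have "\<dots> = (\<Sum>is | length is = Suc k. F is)"
    by (rule sum.reindex_bij_witness[where i = "\<lambda>is. (tl is, hd is)" and j = "\<lambda>(is, i). i # is"])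
      (auto simp: length_Suc_conv)
  finally show ?thesis by simp
qed

text \<open>The sum of the energies of all derivatives of order \<open>k\<close>. It is comparable with the energy of
\<open>grad_norm k f\<close>, and unlike the latter it is additive in the single derivatives, so that first-order
estimates can be applied to each of them.\<close>

definition deriv_energy :: "real \<Rightarrow> real \<Rightarrow> nat \<Rightarrow> (real ^ 'n::finite \<Rightarrow> real) \<Rightarrow> ennreal" where
  "deriv_energy p \<theta> k f = (\<Sum>is | length is = k. energy p \<theta> (iter_partial_deriv is f))"

lemma deriv_energy_0 [simp]: "deriv_energy p \<theta> 0 f = energy p \<theta> f"
  by (simp add: deriv_energy_def)

lemma deriv_energy_Suc:
  "deriv_energy p \<theta> (Suc k) f = (\<Sum>is | length is = k. \<Sum>i\<in>UNIV. energy p \<theta> (partial_deriv i (iter_partial_deriv is f)))"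
  by (simp add: deriv_energy_def sum_lists_Suc)

lemma energy_le_deriv_energy:
  "energy p \<theta> (iter_partial_deriv is f) \<le> deriv_energy p \<theta> (length is) f"
  unfolding deriv_energy_def by (rule member_le_sum) (auto intro: finite_lists_of_length)

lemma energy_mono:
  assumes "0 \<le> p" "\<And>x. \<bar>f x\<bar> \<le> \<bar>g x\<bar>"
  shows "energy p \<theta> f \<le> energy p \<theta> g"
  unfolding energy_def using assms
  by (intro nn_integral_mono mult_right_mono ennreal_leI powr_mono2) auto

lemma deriv_energy_le_grad_norm:
  fixes f :: "real ^ 'n::finite \<Rightarrow> real"
  assumes "0 \<le> p"
  shows "deriv_energy p \<theta> k f \<le> ennreal (real (card {is::'n list. length is = k})) * energy p \<theta> (grad_norm k f)"
proof -
  have "deriv_energy p \<theta> k f \<le> (\<Sum>is::'n list | length is = k. energy p \<theta> (grad_norm k f))"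
    unfolding deriv_energy_def
  proof (intro sum_mono energy_mono assms)
    fix "is" :: "'n list" and x assume "is \<in> {is. length is = k}"
    then have "\<bar>iter_partial_deriv is f x\<bar> \<le> L2_set (\<lambda>is. \<bar>iter_partial_deriv is f x\<bar>) {is. length is = k}"
      by (intro member_le_L2_set finite_lists_of_length)
    then show "\<bar>iter_partial_deriv is f x\<bar> \<le> \<bar>grad_norm k f x\<bar>"
      by (simp add: grad_norm_def L2_set_def)
  qed
  then show ?thesis by (simp add: ennreal_of_nat_eq_real_of_nat)
qed

lemma grad_norm_le_deriv_energy:
  fixes f :: "real ^ 'n::finite \<Rightarrow> real"
  assumes p: "0 < p" and f: "smooth f"
  shows "energy p \<theta> (grad_norm k f) \<le> ennreal (real (card {is::'n list. length is = k}) powr p) * deriv_energy p \<theta> k f"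
proof -
  let ?A = "{is::'n list. length is = k}"
  have [measurable]: "iter_partial_deriv is f \<in> borel_measurable borel" for "is"
    using f by (intro smooth_borel_measurable smooth_iter_partial_deriv)
  have ptw: "ennreal (\<bar>grad_norm k f x\<bar> powr p) \<le> ennreal (real (card ?A) powr p) * (\<Sum>is\<in>?A. ennreal (\<bar>iter_partial_deriv is f x\<bar> powr p))" for x
  proof -
    have "\<bar>grad_norm k f x\<bar> powr p \<le> (\<Sum>is\<in>?A. \<bar>iter_partial_deriv is f x\<bar>) powr p"
      unfolding grad_norm_def using p by (intro powr_mono2) (auto simp: L2_set_le_sum_abs)
    also have "\<dots> \<le> real (card ?A) powr p * (\<Sum>is\<in>?A. \<bar>iter_partial_deriv is f x\<bar> powr p)"
      using p by (intro powr_sum_le finite_lists_of_length) auto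
    finally have "ennreal (\<bar>grad_norm k f x\<bar> powr p) \<le> ennreal (real (card ?A) powr p * (\<Sum>is\<in>?A. \<bar>iter_partial_deriv is f x\<bar> powr p))"
      by (rule ennreal_leI)
    then show ?thesis by (simp add: ennreal_mult sum_nonneg)
  qed
  have "energy p \<theta> (grad_norm k f) \<le> (\<integral>\<^sup>+x. ennreal (real (card ?A) powr p) * (\<Sum>is\<in>?A. ennreal (\<bar>iter_partial_deriv is f x\<bar> powr p)) * pweight \<theta> x \<partial>lborel)"
    unfolding energy_def by (intro nn_integral_mono mult_right_mono ptw) simp
  also have "\<dots> = ennreal (real (card ?A) powr p) * deriv_energy p \<theta> k f"
    unfolding deriv_energy_def energy_def
    by (simp add: mult.assoc sum_distrib_right nn_integral_cmult nn_integral_sum del: sum_ennreal)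
  finally show ?thesis .
qed

lemma energy_finite:
  fixes f :: "real ^ 'n::finite \<Rightarrow> real"
  assumes \<theta>: "- real CARD('n) < \<theta>" "\<theta> \<le> 0" and p: "0 < p" and f: "f \<in> test_functions UNIV"
  shows "energy p \<theta> f < \<infinity>"
proof -
  have fs: "smooth f" using f by (simp add: test_functions_def)
  obtain R where R: "0 < R" "closure {x. f x \<noteq> 0} \<subseteq> ball 0 R"
    using f bounded_subset_ballD[of "closure {x. f x \<noteq> 0}" 0] by (auto simp: test_functions_def compact_imp_bounded)
  have f0: "f x = 0" if "R \<le> norm x" for x
    using R(2) that closure_subset[of "{x. f x \<noteq> 0}"] by (force simp: subset_iff)
  have "energy_far p \<theta> R f = (\<integral>\<^sup>+x. 0 \<partial>(lborel::(real^'n) measure))"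
    unfolding energy_far_def using p by (intro nn_integral_cong) (auto simp: indicator_def f0)
  then show ?thesis
    using energy_split[OF smooth_borel_measurable[OF fs], of p \<theta> R] energy_near_finite[OF \<theta> p R(1) smooth_continuous_on[OF fs]]
    by simp
qed

lemma deriv_energy_finite:
  fixes f :: "real ^ 'n::finite \<Rightarrow> real"
  assumes "- real CARD('n) < \<theta>" "\<theta> \<le> 0" "0 < p" "f \<in> test_functions UNIV"
  shows "deriv_energy p \<theta> k f < \<infinity>"
  unfolding deriv_energy_def
  using energy_finite[OF assms(1-3)] assms(4)
  by (simp add: less_top finite_lists_of_length test_functions_iter_partial_deriv)

lemma poincare:
  fixes \<theta> p :: real
  assumes \<theta>: "- real CARD('n::finite) < \<theta>" "\<theta> \<le> 0" and p: "1 < p"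
  shows "\<exists>C>0. \<forall>\<delta>>0. \<forall>x\<^sub>0. \<forall>f\<in>test_functions (ball (x\<^sub>0::real^'n) \<delta>).
    energy p \<theta> f \<le> ennreal (C * \<delta> powr (p * real m)) * deriv_energy p \<theta> m f"
proof -
  obtain C where C: "0 < C" "\<And>\<delta> x0 f. 0 < \<delta> \<Longrightarrow> f \<in> test_functions (ball (x0::real^'n) \<delta>) \<Longrightarrow>
    energy p \<theta> f \<le> ennreal (C * \<delta> powr p) * (\<Sum>i\<in>UNIV. energy p \<theta> (partial_deriv i f))"
    using poincare_first_order[OF assms] by blast
  have "energy p \<theta> f \<le> ennreal (C ^ m * \<delta> powr (p * real m)) * deriv_energy p \<theta> m f"
    if \<delta>: "0 < \<delta>" and f: "f \<in> test_functions (ball (x0::real^'n) \<delta>)" for \<delta> x0 f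
  proof (induction m)
    case 0
    then show ?case using \<delta> by simp
  next
    case (Suc k)
    have "deriv_energy p \<theta> k f \<le> (\<Sum>is | length is = k. ennreal (C * \<delta> powr p) * (\<Sum>i\<in>UNIV. energy p \<theta> (partial_deriv i (iter_partial_deriv is f))))"
      unfolding deriv_energy_def using f \<delta> by (intro sum_mono C(2) test_functions_iter_partial_deriv)
    also have "\<dots> = ennreal (C * \<delta> powr p) * deriv_energy p \<theta> (Suc k) f"
      by (simp add: deriv_energy_Suc sum_distrib_left)
    finally have "ennreal (C ^ k * \<delta> powr (p * real k)) * deriv_energy p \<theta> k f
        \<le> ennreal (C ^ k * \<delta> powr (p * real k)) * (ennreal (C * \<delta> powr p) * deriv_energy p \<theta> (Suc k) f)"
      by (rule mult_left_mono) simp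
    also have "\<dots> = ennreal (C ^ Suc k * \<delta> powr (p * real (Suc k))) * deriv_energy p \<theta> (Suc k) f"
    proof -
      have eq: "C ^ Suc k * \<delta> powr (p * real (Suc k)) = (C ^ k * \<delta> powr (p * real k)) * (C * \<delta> powr p)"
        using \<delta> by (simp add: distrib_left powr_add)
      have "ennreal (C ^ Suc k * \<delta> powr (p * real (Suc k))) = ennreal (C ^ k * \<delta> powr (p * real k)) * ennreal (C * \<delta> powr p)"
        unfolding eq using C(1) by (intro ennreal_mult) auto
      then show ?thesis by (simp only: mult.assoc)
    qed
    finally show ?case using Suc by (rule order_trans[rotated])
  qed
  then show ?thesis using C(1) by (intro exI[of _ "C ^ m"]) auto
qed

lemma interpolation_consecutive:
  fixes \<theta> p :: real
  assumes \<theta>: "- real CARD('n::finite) < \<theta>" "\<theta> \<le> 0" and p: "1 < p"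
  shows "\<exists>C>0. \<forall>\<delta>>0. \<forall>f::real^'n \<Rightarrow> real. \<forall>k. smooth f \<longrightarrow>
    deriv_energy p \<theta> (Suc k) f \<le> ennreal C * (ennreal (\<delta> powr - p) * deriv_energy p \<theta> k f
      + ennreal (\<delta> powr p) * deriv_energy p \<theta> (Suc (Suc k)) f)"
proof -
  obtain C where C: "0 < C" "\<And>\<delta> (f::real^'n \<Rightarrow> real) i. 0 < \<delta> \<Longrightarrow> smooth f \<Longrightarrow>
    energy p \<theta> (partial_deriv i f) \<le> ennreal C * (ennreal (\<delta> powr - p) * energy p \<theta> f
      + ennreal (\<delta> powr p) * (\<Sum>j\<in>UNIV. energy p \<theta> (partial_deriv j (partial_deriv i f))))"
    using interpolation_first_order[OF assms] by blast
  let ?n = "real CARD('n)"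
  have n: "1 \<le> ?n" by (simp add: Suc_leI)
  show ?thesis
  proof (intro exI conjI allI impI)
    show "0 < C * ?n" using C by simp
    fix \<delta> :: real and f :: "real^'n \<Rightarrow> real" and k :: nat
    assume \<delta>: "0 < \<delta>" and f: "smooth f"
    let ?D = "\<lambda>is. iter_partial_deriv is f"
    have "deriv_energy p \<theta> (Suc k) f \<le> (\<Sum>is | length is = k. \<Sum>i\<in>UNIV. ennreal C * (ennreal (\<delta> powr - p) * energy p \<theta> (?D is)
      + ennreal (\<delta> powr p) * (\<Sum>j\<in>UNIV. energy p \<theta> (partial_deriv j (partial_deriv i (?D is))))))"
      unfolding deriv_energy_Suc by (intro sum_mono C(2) \<delta> smooth_iter_partial_deriv f)
    also have "\<dots> = ennreal C * (ennreal (\<delta> powr - p) * (ennreal ?n * deriv_energy p \<theta> k f)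
      + ennreal (\<delta> powr p) * deriv_energy p \<theta> (Suc (Suc k)) f)"
    proof -
      have "deriv_energy p \<theta> (Suc (Suc k)) f = (\<Sum>is | length is = k. \<Sum>i\<in>UNIV. \<Sum>j\<in>UNIV. energy p \<theta> (partial_deriv j (partial_deriv i (?D is))))"
        by (simp add: deriv_energy_def sum_lists_Suc)
      moreover have "(\<Sum>is::'n list | length is = k. \<Sum>i\<in>(UNIV::'n set). energy p \<theta> (?D is)) = ennreal ?n * deriv_energy p \<theta> k f"
        by (simp add: deriv_energy_def sum_distrib_left ennreal_of_nat_eq_real_of_nat)
      ultimately show ?thesis
        by (simp only: sum_distrib_left[symmetric] sum.distrib)
    qed
    also have "\<dots> \<le> ennreal C * (ennreal (\<delta> powr - p) * (ennreal ?n * deriv_energy p \<theta> k f)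
      + ennreal (\<delta> powr p) * (ennreal ?n * deriv_energy p \<theta> (Suc (Suc k)) f))"
      using n by (intro mult_left_mono add_left_mono ennreal_le_mult_of_ge_1) auto
    also have "\<dots> = ennreal (C * ?n) * (ennreal (\<delta> powr - p) * deriv_energy p \<theta> k f
      + ennreal (\<delta> powr p) * deriv_energy p \<theta> (Suc (Suc k)) f)"
      using C by (simp add: ennreal_mult distrib_left mult_ac)
    finally show "deriv_energy p \<theta> (Suc k) f \<le> ennreal (C * ?n) * (ennreal (\<delta> powr - p) * deriv_energy p \<theta> k f
      + ennreal (\<delta> powr p) * deriv_energy p \<theta> (Suc (Suc k)) f)" .
  qed
qed

text \<open>The induction step of the interpolation inequality. Interpolating order \<open>m\<close> between \<open>m - 1\<close> and
\<open>m + 1\<close> at scale \<open>\<delta>\<close>, and order \<open>m - 1\<close> between \<open>0\<close> and \<open>m\<close> at the scale \<open>c * \<delta>\<close> with a suitable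
\<open>c\<close>, bounds the energy of order \<open>m\<close> by half of itself plus the admissible terms. Absorption requires
that the energy is finite, hence the restriction to test functions.\<close>

lemma interpolation_penultimate:
  fixes \<theta> p :: real
  assumes \<theta>: "- real CARD('n::finite) < \<theta>" "\<theta> \<le> 0" and p: "1 < p"
    and IH: "\<exists>C>0. \<forall>\<delta>>0. \<forall>f\<in>test_functions (UNIV::(real^'n) set). \<forall>j\<le>m. deriv_energy p \<theta> j f
      \<le> ennreal C * (ennreal (\<delta> powr (p * (real m - real j))) * deriv_energy p \<theta> m f + ennreal (\<delta> powr - (p * real j)) * energy p \<theta> f)"
  shows "\<exists>C>0. \<forall>\<delta>>0. \<forall>f\<in>test_functions (UNIV::(real^'n) set). deriv_energy p \<theta> m f
    \<le> ennreal C * (ennreal (\<delta> powr p) * deriv_energy p \<theta> (Suc m) f + ennreal (\<delta> powr - (p * real m)) * energy p \<theta> f)"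
proof (cases m)
  case 0
  then show ?thesis by (intro exI[of _ 1]) auto
next
  case (Suc k)
  obtain C0 where C0: "0 < C0" "\<And>\<delta> f j. 0 < \<delta> \<Longrightarrow> f \<in> test_functions (UNIV::(real^'n) set) \<Longrightarrow> j \<le> m \<Longrightarrow>
      deriv_energy p \<theta> j f \<le> ennreal C0 * (ennreal (\<delta> powr (p * (real m - real j))) * deriv_energy p \<theta> m f + ennreal (\<delta> powr - (p * real j)) * energy p \<theta> f)"
    using IH by blast
  obtain C1 where C1: "0 < C1" "\<And>\<delta> (f::real^'n \<Rightarrow> real) k. 0 < \<delta> \<Longrightarrow> smooth f \<Longrightarrow>
      deriv_energy p \<theta> (Suc k) f \<le> ennreal C1 * (ennreal (\<delta> powr - p) * deriv_energy p \<theta> k f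
      + ennreal (\<delta> powr p) * deriv_energy p \<theta> (Suc (Suc k)) f)"
    using interpolation_consecutive[OF \<theta> p] by blast
  \<comment> \<open>The ratio of the two scales, chosen so that the coefficient \<open>C1 * C0 * c powr p\<close> of the
    term to be absorbed is \<open>1 / 2\<close>.\<close>
  define c where "c = (1 / (2 * C0 * C1)) powr (1 / p)"
  have c: "0 < c" using C0 C1 by (simp add: c_def)
  have cp: "C1 * C0 * c powr p = 1 / 2"
    using C0 C1 p by (simp add: c_def powr_powr)
  define M where "M = C1 * C0 * c powr - (p * real k)"
  have M: "0 < M" using C0 C1 c by (simp add: M_def)
  show ?thesis
  proof (intro exI conjI allI impI ballI)
    show "0 < 2 * (C1 + M)" using C1 M by simp
    fix \<delta> :: real and f :: "real^'n \<Rightarrow> real"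
    assume \<delta>: "0 < \<delta>" and f: "f \<in> test_functions UNIV"
    let ?E = "\<lambda>k. deriv_energy p \<theta> k f" and ?e = "energy p \<theta> f"
    have s: "smooth f" using f by (rule test_functions_smooth)
    have "?E m \<le> ennreal C1 * (ennreal (\<delta> powr - p) * ?E k + ennreal (\<delta> powr p) * ?E (Suc m))"
      using C1(2)[OF \<delta> s, of k] Suc by simp
    also have "\<dots> \<le> ennreal C1 * (ennreal (\<delta> powr - p) * (ennreal C0 * (ennreal ((c * \<delta>) powr p) * ?E m + ennreal ((c * \<delta>) powr - (p * real k)) * ?e))
        + ennreal (\<delta> powr p) * ?E (Suc m))"
      using C0(2)[of "c * \<delta>" f k] c \<delta> f Suc by (intro mult_left_mono add_right_mono) (auto simp: algebra_simps)
    also have "\<dots> = ennreal (C1 * \<delta> powr - p * C0 * (c * \<delta>) powr p) * ?E m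
        + (ennreal (C1 * \<delta> powr - p * C0 * (c * \<delta>) powr - (p * real k)) * ?e + ennreal (C1 * \<delta> powr p) * ?E (Suc m))"
      using C0 C1 by (simp add: ennreal_mult distrib_left mult_ac add_ac)
    also have "C1 * \<delta> powr - p * C0 * (c * \<delta>) powr p = (C1 * C0 * c powr p) * (\<delta> powr - p * \<delta> powr p)"
      using c \<delta> by (simp add: powr_mult)
    also have "\<dots> = 1 / 2" using \<delta> cp by (simp add: powr_add[symmetric])
    also have "C1 * \<delta> powr - p * C0 * (c * \<delta>) powr - (p * real k) = M * \<delta> powr - (p * real m)"
      using c \<delta> by (simp add: M_def powr_mult Suc mult_ac powr_add[symmetric] algebra_simps)
    finally have "?E m \<le> ennreal (1/2) * ?E m + (ennreal (M * \<delta> powr - (p * real m)) * ?e + ennreal (C1 * \<delta> powr p) * ?E (Suc m))" .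
    then have "?E m \<le> ennreal (1 / (1 - 1/2)) * (ennreal (M * \<delta> powr - (p * real m)) * ?e + ennreal (C1 * \<delta> powr p) * ?E (Suc m))"
      using p by (intro ennreal_absorb deriv_energy_finite \<theta> f) auto
    also have "\<dots> \<le> ennreal 2 * (ennreal ((C1 + M) * \<delta> powr - (p * real m)) * ?e + ennreal ((C1 + M) * \<delta> powr p) * ?E (Suc m))"
      using C1 M by (intro mult_mono add_mono ennreal_leI mult_right_mono) auto
    also have "\<dots> = ennreal (2 * (C1 + M)) * (ennreal (\<delta> powr p) * ?E (Suc m) + ennreal (\<delta> powr - (p * real m)) * ?e)"
    proof -
      have "ennreal 2 * (ennreal (K * a) * x + ennreal (K * b) * y) = ennreal (2 * K) * (ennreal b * y + ennreal a * x)"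
        if "0 \<le> K" "0 \<le> a" "0 \<le> b" for K a b :: real and x y :: ennreal
        using that by (simp add: ennreal_mult distrib_left mult_ac add_ac)
      then show ?thesis using C1 M by simp
    qed
    finally show "?E m \<le> ennreal (2 * (C1 + M)) * (ennreal (\<delta> powr p) * ?E (Suc m) + ennreal (\<delta> powr - (p * real m)) * ?e)" .
  qed
qed

lemma interpolation:
  fixes \<theta> p :: real
  assumes \<theta>: "- real CARD('n::finite) < \<theta>" "\<theta> \<le> 0" and p: "1 < p"
  shows "\<exists>C>0. \<forall>\<delta>>0. \<forall>f\<in>test_functions (UNIV::(real^'n) set). \<forall>j\<le>m. deriv_energy p \<theta> j f
      \<le> ennreal C * (ennreal (\<delta> powr (p * (real m - real j))) * deriv_energy p \<theta> m f + ennreal (\<delta> powr - (p * real j)) * energy p \<theta> f)"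
proof (induction m)
  case 0
  show ?case by (intro exI[of _ 1]) auto
next
  case (Suc m)
  obtain C0 where C0: "0 < C0" "\<And>\<delta> f j. 0 < \<delta> \<Longrightarrow> f \<in> test_functions (UNIV::(real^'n) set) \<Longrightarrow> j \<le> m \<Longrightarrow>
      deriv_energy p \<theta> j f \<le> ennreal C0 * (ennreal (\<delta> powr (p * (real m - real j))) * deriv_energy p \<theta> m f + ennreal (\<delta> powr - (p * real j)) * energy p \<theta> f)"
    using Suc.IH by blast
  obtain C2 where C2: "0 < C2" "\<And>\<delta> f. 0 < \<delta> \<Longrightarrow> f \<in> test_functions (UNIV::(real^'n) set) \<Longrightarrow>
      deriv_energy p \<theta> m f \<le> ennreal C2 * (ennreal (\<delta> powr p) * deriv_energy p \<theta> (Suc m) f + ennreal (\<delta> powr - (p * real m)) * energy p \<theta> f)"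
    using interpolation_penultimate[OF assms Suc.IH] by blast
  define C where "C = C0 * C2 + C0 + 1"
  have C: "0 < C" "C0 * C2 \<le> C" "C0 * C2 + C0 \<le> C" "1 \<le> C" using C0 C2 by (auto simp: C_def add_pos_pos)
  show ?case
  proof (intro exI conjI allI impI ballI)
    show "0 < C" by (rule C)
    fix \<delta> :: real and f :: "real^'n \<Rightarrow> real" and j :: nat
    assume \<delta>: "0 < \<delta>" and f: "f \<in> test_functions UNIV" and j: "j \<le> Suc m"
    let ?E = "\<lambda>k. deriv_energy p \<theta> k f" and ?e = "energy p \<theta> f"
    show "?E j \<le> ennreal C * (ennreal (\<delta> powr (p * (real (Suc m) - real j))) * ?E (Suc m) + ennreal (\<delta> powr - (p * real j)) * ?e)"
    proof (cases "j = Suc m")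
      case True
      have "?E j \<le> ennreal C * ?E j"
        using C by (intro ennreal_le_mult_of_ge_1)
      also have "\<dots> \<le> ennreal C * (ennreal (\<delta> powr (p * (real (Suc m) - real j))) * ?E (Suc m) + ennreal (\<delta> powr - (p * real j)) * ?e)"
        using True \<delta> by (intro mult_left_mono) auto
      finally show ?thesis .
    next
      case False
      then have "?E j \<le> ennreal C0 * (ennreal (\<delta> powr (p * (real m - real j))) * ?E m + ennreal (\<delta> powr - (p * real j)) * ?e)"
        using j by (intro C0(2) \<delta> f) auto
      also have "\<dots> \<le> ennreal C0 * (ennreal (\<delta> powr (p * (real m - real j))) * (ennreal C2 * (ennreal (\<delta> powr p) * ?E (Suc m) + ennreal (\<delta> powr - (p * real m)) * ?e))
         + ennreal (\<delta> powr - (p * real j)) * ?e)"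
        by (intro mult_left_mono add_right_mono C2(2) \<delta> f) auto
      also have "\<dots> = ennreal (C0 * C2 * (\<delta> powr (p * (real m - real j)) * \<delta> powr p)) * ?E (Suc m)
         + (ennreal (C0 * C2 * (\<delta> powr (p * (real m - real j)) * \<delta> powr - (p * real m))) + ennreal (C0 * \<delta> powr - (p * real j))) * ?e"
        using C0 C2 by (simp add: ennreal_mult algebra_simps)
      also have "\<dots> = ennreal (C0 * C2 * \<delta> powr (p * (real (Suc m) - real j))) * ?E (Suc m) + ennreal ((C0 * C2 + C0) * \<delta> powr - (p * real j)) * ?e"
        using C0 C2 by (simp add: powr_add[symmetric] ennreal_plus[symmetric] distrib_right del: ennreal_plus) (simp add: algebra_simps)
      also have "\<dots> \<le> ennreal (C * \<delta> powr (p * (real (Suc m) - real j))) * ?E (Suc m) + ennreal (C * \<delta> powr - (p * real j)) * ?e"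
        using C by (intro add_mono mult_right_mono ennreal_leI) auto
      also have "\<dots> = ennreal C * (ennreal (\<delta> powr (p * (real (Suc m) - real j))) * ?E (Suc m) + ennreal (\<delta> powr - (p * real j)) * ?e)"
        using C by (simp add: ennreal_mult distrib_left mult.assoc)
      finally show ?thesis .
    qed
  qed
qed

section \<open>Averaging over translated cutoffs\<close>

text \<open>By Tonelli's theorem, averaging \<open>F\<close> times a translated and rescaled cutoff over all translations
decouples the two factors. In this way a local estimate can be summed over all balls of a given
radius without a covering or a partition of unity.\<close>

lemma nn_integral_average_cutoff:
  fixes F G :: "'a::euclidean_space \<Rightarrow> ennreal"
  assumes [measurable]: "F \<in> borel_measurable borel" "G \<in> borel_measurable borel" and c: "0 < c"
  shows "ennreal (c ^ DIM('a)) * (\<integral>\<^sup>+a. (\<integral>\<^sup>+x. F x * G (c *\<^sub>R (x - a)) \<partial>lborel) \<partial>lborel)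
    = (\<integral>\<^sup>+x. F x \<partial>lborel) * (\<integral>\<^sup>+x. G x \<partial>lborel)"
proof -
  \<comment> \<open>The substitution \<open>y = c * (x - a)\<close> in the variable \<open>a\<close>.\<close>
  have inner: "ennreal (c ^ DIM('a)) * (\<integral>\<^sup>+a. G (c *\<^sub>R (x - a)) \<partial>lborel) = (\<integral>\<^sup>+y. G y \<partial>lborel)" for x
  proof -
    have "(\<integral>\<^sup>+y. G y \<partial>lborel) = (\<integral>\<^sup>+y. G (y + c *\<^sub>R x) \<partial>lborel)"
      by (rule nn_integral_lborel_translate[symmetric]) measurable
    also have "\<dots> = ennreal (\<bar>- c\<bar> ^ DIM('a)) * (\<integral>\<^sup>+a. G ((- c) *\<^sub>R a + c *\<^sub>R x) \<partial>lborel)"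
      using c by (intro nn_integral_lborel_dilate) auto
    finally show ?thesis using c by (simp add: scaleR_diff_right)
  qed
  have "(\<integral>\<^sup>+a. (\<integral>\<^sup>+x. F x * G (c *\<^sub>R (x - a)) \<partial>lborel) \<partial>lborel)
      = (\<integral>\<^sup>+x. (\<integral>\<^sup>+a. F x * G (c *\<^sub>R (x - a)) \<partial>lborel) \<partial>lborel)"
    by (rule lborel_pair.Fubini') measurable
  also have "\<dots> = (\<integral>\<^sup>+x. F x * (\<integral>\<^sup>+a. G (c *\<^sub>R (x - a)) \<partial>lborel) \<partial>lborel)"
    by (intro nn_integral_cong nn_integral_cmult) measurable
  finally have "ennreal (c ^ DIM('a)) * (\<integral>\<^sup>+a. (\<integral>\<^sup>+x. F x * G (c *\<^sub>R (x - a)) \<partial>lborel) \<partial>lborel)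
      = ennreal (c ^ DIM('a)) * (\<integral>\<^sup>+x. F x * (\<integral>\<^sup>+a. G (c *\<^sub>R (x - a)) \<partial>lborel) \<partial>lborel)" by simp
  also have "\<dots> = (\<integral>\<^sup>+x. F x * (ennreal (c ^ DIM('a)) * (\<integral>\<^sup>+a. G (c *\<^sub>R (x - a)) \<partial>lborel)) \<partial>lborel)"
    by (subst nn_integral_cmult[symmetric]) (auto simp: mult_ac)
  also have "\<dots> = (\<integral>\<^sup>+x. F x \<partial>lborel) * (\<integral>\<^sup>+x. G x \<partial>lborel)"
    by (simp add: inner nn_integral_multc)
  finally show ?thesis .
qed

lemma energy_unweighted:
  fixes f :: "real ^ 'n::finite \<Rightarrow> real"
  shows "energy p 0 f = (\<integral>\<^sup>+x. ennreal (\<bar>f x\<bar> powr p) \<partial>lborel)"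
  unfolding energy_def pweight_def
  using AE_lborel_singleton[of "0::real^'n"] by (intro nn_integral_cong_AE, elim eventually_mono) auto

lemma energy_unweighted_pos:
  fixes f :: "real ^ 'n::finite \<Rightarrow> real"
  assumes f: "continuous_on UNIV f" and x: "f x \<noteq> 0"
  shows "energy p 0 f > 0"
proof (rule ccontr)
  have [measurable]: "f \<in> borel_measurable borel" using f by (rule borel_measurable_continuous_onI)
  assume "\<not> energy p 0 f > 0"
  then have "(\<integral>\<^sup>+x. ennreal (\<bar>f x\<bar> powr p) \<partial>lborel) = 0" by (simp add: energy_unweighted)
  then have "AE x in lborel. f x = 0"
    by (subst (asm) nn_integral_0_iff_AE) auto
  then have "{x. f x \<noteq> 0} \<in> null_sets lborel" by (subst (asm) AE_iff_null) auto
  then have "negligible {x. f x \<noteq> 0}"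
    by (simp add: negligible_iff_null_sets null_sets_completionI)
  moreover have "open {x. f x \<noteq> 0}"
    using f by (intro open_Collect_neq continuous_intros)
  ultimately show False using open_not_negligible x by blast
qed

text \<open>The Leibniz rule and the comparison of the power of a sum with the sum of the powers. The integrals
keep the two factors apart, in the form required for averaging.\<close>

lemma energy_iter_partial_deriv_mult_le:
  fixes f g :: "real ^ 'n::finite \<Rightarrow> real"
  assumes p: "0 < p" and f: "smooth f" and g: "smooth g"
  shows "energy p \<theta> (iter_partial_deriv is (\<lambda>x. f x * g x)) \<le>
    ennreal (real (length (leibniz_splits is)) powr p) *
      (\<Sum>k<length (leibniz_splits is). \<integral>\<^sup>+x. ennreal (\<bar>iter_partial_deriv (fst (leibniz_splits is ! k)) f x\<bar> powr p) * pweight \<theta> x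
         * ennreal (\<bar>iter_partial_deriv (snd (leibniz_splits is ! k)) g x\<bar> powr p) \<partial>lborel)"
proof -
  let ?L = "length (leibniz_splits is)"
  let ?F = "\<lambda>k. iter_partial_deriv (fst (leibniz_splits is ! k)) f"
  let ?G = "\<lambda>k. iter_partial_deriv (snd (leibniz_splits is ! k)) g"
  have [measurable]: "?F k \<in> borel_measurable borel" "?G k \<in> borel_measurable borel" for k
    using f g by (auto intro!: smooth_borel_measurable smooth_iter_partial_deriv)
  have ptw: "ennreal (\<bar>iter_partial_deriv is (\<lambda>x. f x * g x) x\<bar> powr p)
    \<le> ennreal (real ?L powr p) * (\<Sum>k<?L. ennreal (\<bar>?F k x\<bar> powr p) * ennreal (\<bar>?G k x\<bar> powr p))" for x
  proof -
    have "iter_partial_deriv is (\<lambda>x. f x * g x) x = (\<Sum>k<?L. ?F k x * ?G k x)"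
      by (simp add: iter_partial_deriv_mult[OF f g] sum_list_sum_nth case_prod_unfold atLeast0LessThan)
    then have "\<bar>iter_partial_deriv is (\<lambda>x. f x * g x) x\<bar> \<le> (\<Sum>k<?L. \<bar>?F k x\<bar> * \<bar>?G k x\<bar>)"
      using sum_abs[of "\<lambda>k. ?F k x * ?G k x" "{..<?L}"] by (simp add: abs_mult)
    then have "\<bar>iter_partial_deriv is (\<lambda>x. f x * g x) x\<bar> powr p \<le> (\<Sum>k<?L. \<bar>?F k x\<bar> * \<bar>?G k x\<bar>) powr p"
      using p by (intro powr_mono2) auto
    also have "\<dots> \<le> real (card {..<?L}) powr p * (\<Sum>k<?L. (\<bar>?F k x\<bar> * \<bar>?G k x\<bar>) powr p)"
      using p by (intro powr_sum_le) auto
    also have "\<dots> = real ?L powr p * (\<Sum>k<?L. \<bar>?F k x\<bar> powr p * \<bar>?G k x\<bar> powr p)"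
      by (simp add: powr_mult)
    finally have "ennreal (\<bar>iter_partial_deriv is (\<lambda>x. f x * g x) x\<bar> powr p) \<le> ennreal (real ?L powr p * (\<Sum>k<?L. \<bar>?F k x\<bar> powr p * \<bar>?G k x\<bar> powr p))"
      by (rule ennreal_leI)
    then show ?thesis by (simp add: ennreal_mult sum_nonneg flip: sum_ennreal)
  qed
  have "energy p \<theta> (iter_partial_deriv is (\<lambda>x. f x * g x))
    \<le> (\<integral>\<^sup>+x. ennreal (real ?L powr p) * (\<Sum>k<?L. ennreal (\<bar>?F k x\<bar> powr p) * ennreal (\<bar>?G k x\<bar> powr p)) * pweight \<theta> x \<partial>lborel)"
    unfolding energy_def by (intro nn_integral_mono mult_right_mono ptw) simp
  also have "\<dots> = (\<integral>\<^sup>+x. ennreal (real ?L powr p) * (\<Sum>k<?L. ennreal (\<bar>?F k x\<bar> powr p) * pweight \<theta> x * ennreal (\<bar>?G k x\<bar> powr p)) \<partial>lborel)"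
    by (intro nn_integral_cong) (simp add: sum_distrib_left sum_distrib_right mult_ac)
  also have "\<dots> = ennreal (real ?L powr p) * (\<Sum>k<?L. \<integral>\<^sup>+x. ennreal (\<bar>?F k x\<bar> powr p) * pweight \<theta> x * ennreal (\<bar>?G k x\<bar> powr p) \<partial>lborel)"
    by (simp add: nn_integral_cmult nn_integral_sum)
  finally show ?thesis .
qed

text \<open>The Leibniz rule expresses the integrand by fixed continuous functions of \<open>x\<close> and \<open>c * (x - a)\<close>,
which makes it jointly measurable in \<open>a\<close> and \<open>x\<close>.\<close>

lemma measurable_energy_cutoff_derivative:
  fixes f g :: "real ^ 'n::finite \<Rightarrow> real"
  assumes f: "smooth f" and g: "smooth g"
  shows "(\<lambda>a. energy p \<theta> (iter_partial_deriv is (\<lambda>x. f x * g (c *\<^sub>R (x - a))))) \<in> borel_measurable borel"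
proof -
  have [measurable]: "iter_partial_deriv js f \<in> borel_measurable borel" "iter_partial_deriv js g \<in> borel_measurable borel" for js
    using f g by (auto intro!: smooth_borel_measurable smooth_iter_partial_deriv)
  have "iter_partial_deriv is (\<lambda>x. f x * g (c *\<^sub>R (x - a))) x =
    (\<Sum>k<length (leibniz_splits is). iter_partial_deriv (fst (leibniz_splits is ! k)) f x *
      (c ^ length (snd (leibniz_splits is ! k)) * iter_partial_deriv (snd (leibniz_splits is ! k)) g (c *\<^sub>R (x - a))))" for a x
    by (simp add: iter_partial_deriv_mult[OF f smooth_affine[OF g]] iter_partial_deriv_affine[OF g] sum_list_sum_nth case_prod_unfold atLeast0LessThan)
  then show ?thesis unfolding energy_def by simp
qed

text \<open>A derivative of order \<open>m\<close> of the product is a sum of terms in which \<open>j\<close> derivatives fall on \<open>f\<close> and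
\<open>m - j\<close> on the cutoff. The latter produce the factor \<open>\<delta> powr (- (p * (m - j)))\<close>, which is exactly
compensated by the interpolation of the energy of order \<open>j\<close> at scale \<open>\<delta>\<close>.\<close>

lemma average_energy_cutoff_le:
  fixes \<theta> p :: real and \<eta> :: "real ^ 'n::finite \<Rightarrow> real"
  assumes \<theta>: "- real CARD('n) < \<theta>" "\<theta> \<le> 0" and p: "1 < p"
    and \<eta>: "\<eta> \<in> test_functions UNIV"
  shows "\<exists>M>0. \<forall>\<delta>>0. \<forall>f\<in>test_functions UNIV.
    ennreal ((1 / \<delta>) ^ CARD('n)) * (\<integral>\<^sup>+a. energy p \<theta> (iter_partial_deriv is (\<lambda>x. f x * \<eta> ((1 / \<delta>) *\<^sub>R (x - a)))) \<partial>lborel)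
      \<le> ennreal M * (deriv_energy p \<theta> (length is) f + ennreal (\<delta> powr - (p * real (length is))) * energy p \<theta> f)"
proof -
  define m where "m = length is"
  obtain C where C: "0 < C" "\<And>\<delta> f j. 0 < \<delta> \<Longrightarrow> f \<in> test_functions (UNIV::(real^'n) set) \<Longrightarrow> j \<le> m \<Longrightarrow>
      deriv_energy p \<theta> j f \<le> ennreal C * (ennreal (\<delta> powr (p * (real m - real j))) * deriv_energy p \<theta> m f + ennreal (\<delta> powr - (p * real j)) * energy p \<theta> f)"
    using interpolation[OF \<theta> p, of m] by blast
  have \<eta>s: "smooth \<eta>" using \<eta> by (rule test_functions_smooth)
  let ?L = "length (leibniz_splits is)"
  let ?J = "\<lambda>k. fst (leibniz_splits is ! k)"
  let ?K = "\<lambda>k. snd (leibniz_splits is ! k)"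
  have len: "length (?J k) + length (?K k) = m" if "k < ?L" for k
    unfolding m_def using that by (intro length_leibniz_splits) simp
  define B where "B = (\<lambda>k. enn2real (energy p 0 (iter_partial_deriv (?K k) \<eta>)))"
  have B: "energy p 0 (iter_partial_deriv (?K k) \<eta>) = ennreal (B k)" for k
    unfolding B_def using energy_finite[of 0 p "iter_partial_deriv (?K k) \<eta>"] p \<eta>
    by (simp add: test_functions_iter_partial_deriv ennreal_enn2real)
  have B0: "0 \<le> B k" for k by (simp add: B_def)
  \<comment> \<open>The summand \<open>1\<close> only ensures that \<open>M\<close> is positive.\<close>
  define M where "M = real ?L powr p * (\<Sum>k<?L. B k * C) + 1"
  have M: "0 < M" unfolding M_def using B0 C by (intro add_nonneg_pos mult_nonneg_nonneg sum_nonneg) auto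
  show ?thesis
  proof (intro exI conjI allI impI ballI)
    show "0 < M" by fact
    fix \<delta> :: real and f :: "real^'n \<Rightarrow> real"
    assume \<delta>: "0 < \<delta>" and f: "f \<in> test_functions UNIV"
    define c where "c = 1 / \<delta>"
    have c: "0 < c" using \<delta> by (simp add: c_def)
    have fs: "smooth f" using f by (rule test_functions_smooth)
    have [measurable]: "iter_partial_deriv js f \<in> borel_measurable borel" "iter_partial_deriv js \<eta> \<in> borel_measurable borel" for js
      using fs \<eta>s by (auto intro!: smooth_borel_measurable smooth_iter_partial_deriv)
    let ?X = "deriv_energy p \<theta> m f + ennreal (\<delta> powr - (p * real m)) * energy p \<theta> f"
    let ?F = "\<lambda>k x. ennreal (\<bar>iter_partial_deriv (?J k) f x\<bar> powr p) * pweight \<theta> x"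
    let ?G = "\<lambda>k x. ennreal (\<bar>iter_partial_deriv (?K k) \<eta> x\<bar> powr p)"
    have scale: "ennreal (\<bar>iter_partial_deriv (?K k) (\<lambda>x. \<eta> (c *\<^sub>R (x - a))) x\<bar> powr p)
        = ennreal ((c ^ length (?K k)) powr p) * ?G k (c *\<^sub>R (x - a))" for k a x
      using c by (simp add: iter_partial_deriv_affine[OF \<eta>s] abs_mult powr_mult ennreal_mult)
    have term_le: "ennreal ((c ^ length (?K k)) powr p) * (ennreal (c ^ CARD('n)) * (\<integral>\<^sup>+a. \<integral>\<^sup>+x. ?F k x * ?G k (c *\<^sub>R (x - a)) \<partial>lborel \<partial>lborel))
        \<le> ennreal (B k * C) * ?X" if k: "k < ?L" for k
    proof -
      have "ennreal (c ^ CARD('n)) * (\<integral>\<^sup>+a. \<integral>\<^sup>+x. ?F k x * ?G k (c *\<^sub>R (x - a)) \<partial>lborel \<partial>lborel)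
          = energy p \<theta> (iter_partial_deriv (?J k) f) * ennreal (B k)"
        using nn_integral_average_cutoff[of "?F k" "?G k" c] c
        by (simp add: energy_def[symmetric] energy_unweighted[symmetric] B)
      also have "\<dots> \<le> (ennreal C * (ennreal (\<delta> powr (p * (real m - real (length (?J k))))) * deriv_energy p \<theta> m f
          + ennreal (\<delta> powr - (p * real (length (?J k)))) * energy p \<theta> f)) * ennreal (B k)"
        using len[OF k] by (intro mult_right_mono order_trans[OF energy_le_deriv_energy C(2)] \<delta> f) auto
      finally have "ennreal ((c ^ length (?K k)) powr p) * (ennreal (c ^ CARD('n)) * (\<integral>\<^sup>+a. \<integral>\<^sup>+x. ?F k x * ?G k (c *\<^sub>R (x - a)) \<partial>lborel \<partial>lborel))
        \<le> ennreal ((c ^ length (?K k)) powr p) * ((ennreal C * (ennreal (\<delta> powr (p * (real m - real (length (?J k))))) * deriv_energy p \<theta> m f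
          + ennreal (\<delta> powr - (p * real (length (?J k)))) * energy p \<theta> f)) * ennreal (B k))"
        by (rule mult_left_mono) simp
      also have cK: "(c ^ length (?K k)) powr p = \<delta> powr - (p * real (length (?K k)))"
        using \<delta> by (simp add: c_def powr_realpow[symmetric] powr_powr powr_divide powr_minus_divide mult.commute)
      also have "ennreal (\<delta> powr - (p * real (length (?K k)))) * ((ennreal C * (ennreal (\<delta> powr (p * (real m - real (length (?J k))))) * deriv_energy p \<theta> m f
          + ennreal (\<delta> powr - (p * real (length (?J k)))) * energy p \<theta> f)) * ennreal (B k))
         = ennreal (B k * C) * (ennreal (\<delta> powr - (p * real (length (?K k))) * \<delta> powr (p * (real m - real (length (?J k))))) * deriv_energy p \<theta> m f
          + ennreal (\<delta> powr - (p * real (length (?K k))) * \<delta> powr - (p * real (length (?J k)))) * energy p \<theta> f)"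
        using B0 C by (simp add: ennreal_mult distrib_left mult_ac)
      also have "\<delta> powr - (p * real (length (?K k))) * \<delta> powr (p * (real m - real (length (?J k)))) = 1"
        using \<delta> by (simp add: powr_add[symmetric] len[OF k, symmetric])
      also have "\<delta> powr - (p * real (length (?K k))) * \<delta> powr - (p * real (length (?J k))) = \<delta> powr - (p * real m)"
        by (simp add: powr_add[symmetric] len[OF k, symmetric] algebra_simps)
      finally show ?thesis by (simp add: cK)
    qed
    have "energy p \<theta> (iter_partial_deriv is (\<lambda>x. f x * \<eta> (c *\<^sub>R (x - a)))) \<le> ennreal (real ?L powr p) *
        (\<Sum>k<?L. ennreal ((c ^ length (?K k)) powr p) * (\<integral>\<^sup>+x. ?F k x * ?G k (c *\<^sub>R (x - a)) \<partial>lborel))" for a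
    proof -
      have "(\<integral>\<^sup>+x. ?F k x * ennreal (\<bar>iter_partial_deriv (?K k) (\<lambda>x. \<eta> (c *\<^sub>R (x - a))) x\<bar> powr p) \<partial>lborel)
          = ennreal ((c ^ length (?K k)) powr p) * (\<integral>\<^sup>+x. ?F k x * ?G k (c *\<^sub>R (x - a)) \<partial>lborel)" for k
        by (subst nn_integral_cmult[symmetric]) (auto simp: scale mult_ac)
      then show ?thesis
        using energy_iter_partial_deriv_mult_le[of p f "\<lambda>x. \<eta> (c *\<^sub>R (x - a))" \<theta> "is"] p fs smooth_affine[OF \<eta>s, of c a]
        by simp
    qed
    then have "ennreal (c ^ CARD('n)) * (\<integral>\<^sup>+a. energy p \<theta> (iter_partial_deriv is (\<lambda>x. f x * \<eta> (c *\<^sub>R (x - a)))) \<partial>lborel)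
      \<le> ennreal (c ^ CARD('n)) * (\<integral>\<^sup>+a. ennreal (real ?L powr p) *
        (\<Sum>k<?L. ennreal ((c ^ length (?K k)) powr p) * (\<integral>\<^sup>+x. ?F k x * ?G k (c *\<^sub>R (x - a)) \<partial>lborel)) \<partial>lborel)"
      by (intro mult_left_mono nn_integral_mono) auto
    also have "\<dots> = ennreal (real ?L powr p) * (\<Sum>k<?L. ennreal ((c ^ length (?K k)) powr p) * (ennreal (c ^ CARD('n)) *
        (\<integral>\<^sup>+a. \<integral>\<^sup>+x. ?F k x * ?G k (c *\<^sub>R (x - a)) \<partial>lborel \<partial>lborel)))"
      by (simp add: nn_integral_cmult nn_integral_sum sum_distrib_left mult_ac)
    also have "\<dots> \<le> ennreal (real ?L powr p) * (\<Sum>k<?L. ennreal (B k * C) * ?X)"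
      by (intro mult_left_mono sum_mono term_le) auto
    also have "\<dots> = ennreal (real ?L powr p * (\<Sum>k<?L. B k * C)) * ?X"
      using B0 C by (simp add: sum_distrib_right[symmetric] ennreal_mult sum_nonneg mult.assoc)
    also have "\<dots> \<le> ennreal M * ?X"
      by (intro mult_right_mono ennreal_leI) (auto simp: M_def)
    finally show "ennreal ((1 / \<delta>) ^ CARD('n)) * (\<integral>\<^sup>+a. energy p \<theta> (iter_partial_deriv is (\<lambda>x. f x * \<eta> ((1 / \<delta>) *\<^sub>R (x - a)))) \<partial>lborel)
      \<le> ennreal M * (deriv_energy p \<theta> (length is) f + ennreal (\<delta> powr - (p * real (length is))) * energy p \<theta> f)"
      unfolding c_def m_def .
  qed
qed

lemma L1_loc_borel_measurable:
  assumes "L1_loc V" shows "V \<in> borel_measurable lebesgue"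
proof (rule borel_measurable_LIMSEQ_real)
  fix k :: nat
  show "(\<lambda>x. indicator (cball 0 (real k)) x *\<^sub>R V x) \<in> borel_measurable lebesgue"
    using assms unfolding L1_loc_def set_integrable_def
    by (intro borel_measurable_integrable) simp
next
  fix x
  have "eventually (\<lambda>k. indicator (cball 0 (real k)) x *\<^sub>R V x = V x) sequentially"
    using eventually_ge_at_top[of "nat \<lceil>norm x\<rceil>"] by eventually_elim (auto simp: indicator_def)
  then show "(\<lambda>k. indicator (cball 0 (real k)) x *\<^sub>R V x) \<longlonglongrightarrow> V x"
    by (rule tendsto_eventually)
qed

text \<open>The local estimate is applied to \<open>\<phi>\<close> multiplied by translates of a fixed nonzero test function \<open>\<eta>\<close>,
rescaled to size \<open>\<delta>\<close>, and averaged over all translations. On the left the average produces the full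
energy of \<open>V * \<phi>\<close> times the positive and finite number \<open>A\<close>; on the right the derivatives are handled
by \<open>average_energy_cutoff_le\<close>. The function \<open>V\<close> is replaced by a Borel function equal to it almost
everywhere, since Tonelli's theorem is applied to Lebesgue-Borel measure.\<close>

lemma local_estimate_imp_scaled_estimate:
  fixes V \<eta> :: "real ^ 'n::finite \<Rightarrow> real" and \<theta> p \<gamma> :: real
  assumes \<theta>: "- real CARD('n) < \<theta>" "\<theta> \<le> 0" and p: "1 < p" and V: "V \<in> borel_measurable lebesgue"
    and \<eta>: "\<eta> \<in> test_functions UNIV" "\<eta> z \<noteq> 0"
    and C': "0 < C'" and loc: "\<And>\<delta> x0 \<phi>. 0 < \<delta> \<Longrightarrow> \<phi> \<in> test_functions (ball x0 \<delta>) \<Longrightarrow>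
      energy p \<theta> (\<lambda>x. V x * \<phi> x) \<le> ennreal (C' * \<delta> powr \<gamma>) * energy p \<theta> (grad_norm m \<phi>)"
  shows "\<exists>K>0. \<forall>\<delta>>0. \<forall>\<phi>\<in>test_functions UNIV. energy p \<theta> (\<lambda>x. V x * \<phi> x)
    \<le> ennreal (K * \<delta> powr \<gamma>) * (deriv_energy p \<theta> m \<phi> + ennreal (\<delta> powr - (p * real m)) * energy p \<theta> \<phi>)"
proof -
  have \<eta>s: "smooth \<eta>" using \<eta>(1) by (rule test_functions_smooth)
  obtain R where R: "0 < R" "closure {x. \<eta> x \<noteq> 0} \<subseteq> ball 0 R"
    using \<eta> bounded_subset_ballD[of "closure {x. \<eta> x \<noteq> 0}" 0] by (auto simp: test_functions_def compact_imp_bounded)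
  then have \<eta>R: "\<eta> \<in> test_functions (ball 0 R)" using \<eta> by (simp add: test_functions_def)
  obtain V' where V'[measurable]: "V' \<in> borel_measurable borel" and VV': "AE x in lborel. V x = V' x"
    using completion_ex_borel_measurable_real[OF V] by auto
  have eV: "energy p \<theta> (\<lambda>x. V x * g x) = energy p \<theta> (\<lambda>x. V' x * g x)" for g
    unfolding energy_def using VV' by (intro nn_integral_cong_AE, elim eventually_mono) simp
  define A where "A = enn2real (energy p 0 \<eta>)"
  have "energy p 0 \<eta> < \<infinity>" using p \<eta> by (intro energy_finite) auto
  then have A: "energy p 0 \<eta> = ennreal A" "0 < A"
    using energy_unweighted_pos[OF smooth_continuous_on[OF \<eta>s] \<eta>(2), of p]
    by (simp_all add: A_def ennreal_enn2real enn2real_positive_iff)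
  \<comment> \<open>The constants depend on the multi-index, of which only finitely many have length \<open>m\<close>.\<close>
  have "\<forall>is. \<exists>M>0. \<forall>\<delta>>0. \<forall>f\<in>test_functions UNIV.
    ennreal ((1 / \<delta>) ^ CARD('n)) * (\<integral>\<^sup>+a. energy p \<theta> (iter_partial_deriv is (\<lambda>x. f x * \<eta> ((1 / \<delta>) *\<^sub>R (x - a)))) \<partial>lborel)
      \<le> ennreal M * (deriv_energy p \<theta> (length is) f + ennreal (\<delta> powr - (p * real (length is))) * energy p \<theta> f)"
    using average_energy_cutoff_le[OF \<theta> p \<eta>(1)] by blast
  from choice[OF this] obtain M where M_all: "\<forall>is. 0 < M is \<and> (\<forall>\<delta>>0. \<forall>f\<in>test_functions UNIV.
    ennreal ((1 / \<delta>) ^ CARD('n)) * (\<integral>\<^sup>+a. energy p \<theta> (iter_partial_deriv is (\<lambda>x. f x * \<eta> ((1 / \<delta>) *\<^sub>R (x - a)))) \<partial>lborel)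
      \<le> ennreal (M is) * (deriv_energy p \<theta> (length is) f + ennreal (\<delta> powr - (p * real (length is))) * energy p \<theta> f))" ..
  then have M: "0 < M is" "0 < \<delta> \<Longrightarrow> f \<in> test_functions UNIV \<Longrightarrow>
    ennreal ((1 / \<delta>) ^ CARD('n)) * (\<integral>\<^sup>+a. energy p \<theta> (iter_partial_deriv is (\<lambda>x. f x * \<eta> ((1 / \<delta>) *\<^sub>R (x - a)))) \<partial>lborel)
      \<le> ennreal (M is) * (deriv_energy p \<theta> (length is) f + ennreal (\<delta> powr - (p * real (length is))) * energy p \<theta> f)" for "is" \<delta> f
    by blast+
  let ?N = "real (card {is::'n list. length is = m}) powr p"
  define S where "S = (\<Sum>is::'n list | length is = m. M is)"
  have S: "0 \<le> S" unfolding S_def by (intro sum_nonneg less_imp_le M)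
  define K where "K = (C' * R powr \<gamma> * ?N * S + 1) / A"
  show ?thesis
  proof (intro exI conjI allI impI ballI)
    show "0 < K" unfolding K_def using C' S A by (intro divide_pos_pos add_nonneg_pos mult_nonneg_nonneg) auto
    fix \<delta> :: real and \<phi> :: "real^'n \<Rightarrow> real"
    assume \<delta>: "0 < \<delta>" and \<phi>: "\<phi> \<in> test_functions UNIV"
    have \<phi>s: "smooth \<phi>" using \<phi> by (rule test_functions_smooth)
    note [measurable] = smooth_borel_measurable[OF \<phi>s] smooth_borel_measurable[OF \<eta>s]
    define c where "c = 1 / \<delta>"
    have c: "0 < c" using \<delta> by (simp add: c_def)
    let ?\<psi> = "\<lambda>a x. \<phi> x * \<eta> (c *\<^sub>R (x - a))"
    let ?X = "deriv_energy p \<theta> m \<phi> + ennreal (\<delta> powr - (p * real m)) * energy p \<theta> \<phi>"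
    let ?F = "\<lambda>x. ennreal (\<bar>V' x * \<phi> x\<bar> powr p) * pweight \<theta> x"
    let ?k = "ennreal (C' * (R * \<delta>) powr \<gamma>) * ennreal ?N"
    have \<psi>: "?\<psi> a \<in> test_functions (ball a (R * \<delta>))" for a
      using test_functions_mult_cutoff[OF \<phi>s \<eta>R c, of a] by (simp add: c_def)
    have meas: "(\<lambda>a. energy p \<theta> (iter_partial_deriv is (?\<psi> a))) \<in> borel_measurable borel" for "is"
      using \<phi>s \<eta>s by (rule measurable_energy_cutoff_derivative)
    have piece: "energy p \<theta> (\<lambda>x. V' x * ?\<psi> a x) \<le> ?k * deriv_energy p \<theta> m (?\<psi> a)" for a
    proof -
      have "energy p \<theta> (\<lambda>x. V' x * ?\<psi> a x) \<le> ennreal (C' * (R * \<delta>) powr \<gamma>) * energy p \<theta> (grad_norm m (?\<psi> a))"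
        unfolding eV[symmetric] using R \<delta> by (intro loc[OF _ \<psi>]) auto
      also have "\<dots> \<le> ennreal (C' * (R * \<delta>) powr \<gamma>) * (ennreal ?N * deriv_energy p \<theta> m (?\<psi> a))"
        using p by (intro mult_left_mono grad_norm_le_deriv_energy test_functions_smooth[OF \<psi>]) auto
      finally show ?thesis by (simp add: mult.assoc)
    qed
    have "energy p \<theta> (\<lambda>x. V' x * \<phi> x) * ennreal A
       = ennreal (c ^ CARD('n)) * (\<integral>\<^sup>+a. \<integral>\<^sup>+x. ?F x * ennreal (\<bar>\<eta> (c *\<^sub>R (x - a))\<bar> powr p) \<partial>lborel \<partial>lborel)"
      using nn_integral_average_cutoff[of ?F "\<lambda>x. ennreal (\<bar>\<eta> x\<bar> powr p)" c] c
      by (simp add: energy_def[symmetric] energy_unweighted[symmetric] A)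
    also have "\<dots> = ennreal (c ^ CARD('n)) * (\<integral>\<^sup>+a. energy p \<theta> (\<lambda>x. V' x * ?\<psi> a x) \<partial>lborel)"
      unfolding energy_def by (simp add: abs_mult powr_mult ennreal_mult mult_ac)
    also have "\<dots> \<le> ennreal (c ^ CARD('n)) * (\<integral>\<^sup>+a. ?k * deriv_energy p \<theta> m (?\<psi> a) \<partial>lborel)"
      by (intro mult_left_mono nn_integral_mono piece) auto
    also have "\<dots> = ?k * (\<Sum>is::'n list | length is = m. ennreal (c ^ CARD('n)) * (\<integral>\<^sup>+a. energy p \<theta> (iter_partial_deriv is (?\<psi> a)) \<partial>lborel))"
      unfolding deriv_energy_def using meas
      by (simp add: nn_integral_cmult nn_integral_sum sum_distrib_left mult_ac)
    also have "\<dots> \<le> ?k * (\<Sum>is::'n list | length is = m. ennreal (M is) * ?X)"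
      using M(2)[OF \<delta> \<phi>] by (intro mult_left_mono sum_mono) (auto simp: c_def)
    also have "\<dots> = ennreal (C' * R powr \<gamma> * ?N * S * \<delta> powr \<gamma>) * ?X"
    proof -
      have "(\<Sum>is::'n list | length is = m. ennreal (M is) * ?X) = ennreal S * ?X"
        using less_imp_le[OF M(1)] by (simp add: sum_distrib_right[symmetric] S_def)
      moreover have "?k * ennreal S = ennreal (C' * R powr \<gamma> * ?N * S * \<delta> powr \<gamma>)"
        using C' R \<delta> S by (simp add: ennreal_mult[symmetric] powr_mult mult_ac)
      ultimately show ?thesis by (simp add: mult.assoc[symmetric])
    qed
    also have "\<dots> \<le> ennreal (A * K * \<delta> powr \<gamma>) * ?X"
      using A by (intro mult_right_mono ennreal_leI) (auto simp: K_def)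
    finally have "energy p \<theta> (\<lambda>x. V' x * \<phi> x) * ennreal A \<le> ennreal (A * K * \<delta> powr \<gamma>) * ?X" .
    then have "ennreal A * energy p \<theta> (\<lambda>x. V' x * \<phi> x) \<le> ennreal A * (ennreal (K * \<delta> powr \<gamma>) * ?X)"
      using A \<open>0 < K\<close> by (simp add: ennreal_mult mult_ac)
    then show "energy p \<theta> (\<lambda>x. V x * \<phi> x) \<le> ennreal (K * \<delta> powr \<gamma>) * ?X"
      unfolding eV using A by (subst (asm) ennreal_mult_le_mult_iff) auto
  qed
qed

section \<open>The equivalence\<close>

text \<open>The two parameters are tied by requiring \<open>\<epsilon>\<close> to be proportional to \<open>\<delta> powr \<gamma>\<close> with
\<open>\<gamma> = p * m / (\<beta> + 1)\<close>. Then \<open>\<epsilon> powr (- \<beta>)\<close> is proportional to \<open>\<delta> powr (\<gamma> - p * m)\<close>, the factor that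
scaling dictates for the term without derivatives.\<close>

theorem theorem1p5:
  fixes p \<theta> \<beta> :: real and m :: nat
    and w V :: "real ^ 'n::finite \<Rightarrow> real"
  assumes p: "1 < p"
    and m: "0 < m" "m < CARD('n)"
    and \<theta>: "1 - real CARD('n) < \<theta>" "\<theta> \<le> 0"
    and w: "w = power_weight \<theta>"
    and V: "L1_loc V" "AE x in lebesgue. 0 \<le> V x"
    and \<beta>: "0 < \<beta>"
  shows
    "(\<exists>C>0. \<forall>\<epsilon>>0. \<forall>\<phi>\<in>test_functions UNIV.
        Lp_norm_pow p w (\<lambda>x. V x * \<phi> x)
          \<le> ennreal \<epsilon> * Lp_norm_pow p w (grad_norm m \<phi>)
            + ennreal (C * \<epsilon> powr (- \<beta>)) * Lp_norm_pow p w \<phi>)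
     \<longleftrightarrow>
     (\<exists>C'>0. \<forall>\<delta>>0. \<forall>x\<^sub>0. \<forall>\<phi>\<in>test_functions (ball x\<^sub>0 \<delta>).
        Lp_norm_pow p w (\<lambda>x. V x * \<phi> x)
          \<le> ennreal (C' * \<delta> powr (p * real m / (\<beta> + 1))) * Lp_norm_pow p w (grad_norm m \<phi>))"
proof -
  have E: "Lp_norm_pow p w f = energy p \<theta> f" for f
    by (simp add: w Lp_norm_pow_eq energy_def)
  have n\<theta>: "- real CARD('n) < \<theta>" using \<theta> by simp
  define \<gamma> where "\<gamma> = p * real m / (\<beta> + 1)"
  have \<gamma>: "0 < \<gamma>" using p m \<beta> by (simp add: \<gamma>_def)
  have pm: "p * real m = \<gamma> * (\<beta> + 1)" using \<beta> by (simp add: \<gamma>_def)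
  define N where "N = real (card {is::'n list. length is = m})"
  have "replicate m undefined \<in> {is::'n list. length is = m}" by simp
  then have N: "1 \<le> N" unfolding N_def
    using card_gt_0_iff[of "{is::'n list. length is = m}"] finite_lists_of_length[of m, where 'i = 'n] by fastforce
  have DN: "deriv_energy p \<theta> m f \<le> ennreal N * energy p \<theta> (grad_norm m f)" for f :: "real^'n \<Rightarrow> real"
    unfolding N_def using p by (intro deriv_energy_le_grad_norm) simp
  show ?thesis
    unfolding E \<gamma>_def[symmetric]
  proof
    assume "\<exists>C>0. \<forall>\<epsilon>>0. \<forall>\<phi>\<in>test_functions UNIV. energy p \<theta> (\<lambda>x. V x * \<phi> x)
      \<le> ennreal \<epsilon> * energy p \<theta> (grad_norm m \<phi>) + ennreal (C * \<epsilon> powr (- \<beta>)) * energy p \<theta> \<phi>"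
    then obtain C where C: "0 < C" "\<And>\<epsilon> \<phi>. 0 < \<epsilon> \<Longrightarrow> \<phi> \<in> test_functions UNIV \<Longrightarrow> energy p \<theta> (\<lambda>x. V x * \<phi> x)
      \<le> ennreal \<epsilon> * energy p \<theta> (grad_norm m \<phi>) + ennreal (C * \<epsilon> powr (- \<beta>)) * energy p \<theta> \<phi>"
      by blast
    obtain P where P: "0 < P" "\<And>\<delta> x0 f. 0 < \<delta> \<Longrightarrow> f \<in> test_functions (ball (x0::real^'n) \<delta>) \<Longrightarrow>
      energy p \<theta> f \<le> ennreal (P * \<delta> powr (p * real m)) * deriv_energy p \<theta> m f"
      using poincare[OF n\<theta> \<theta>(2) p, of m] by blast
    show "\<exists>C'>0. \<forall>\<delta>>0. \<forall>x\<^sub>0. \<forall>\<phi>\<in>test_functions (ball x\<^sub>0 \<delta>). energy p \<theta> (\<lambda>x. V x * \<phi> x)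
      \<le> ennreal (C' * \<delta> powr \<gamma>) * energy p \<theta> (grad_norm m \<phi>)"
    proof (intro exI conjI allI impI ballI)
      show "0 < 1 + C * P * N" using C P N by (simp add: add_pos_pos)
      fix \<delta> :: real and x0 and \<phi> :: "real^'n \<Rightarrow> real"
      assume \<delta>: "0 < \<delta>" and \<phi>: "\<phi> \<in> test_functions (ball x0 \<delta>)"
      let ?g = "energy p \<theta> (grad_norm m \<phi>)"
      \<comment> \<open>The global estimate is used with \<open>\<epsilon> = \<delta> powr \<gamma>\<close>, which makes both terms of the same order
        after the Poincare inequality.\<close>
      have "energy p \<theta> (\<lambda>x. V x * \<phi> x) \<le> ennreal (\<delta> powr \<gamma>) * ?g + ennreal (C * (\<delta> powr \<gamma>) powr (- \<beta>)) * energy p \<theta> \<phi>"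
        using \<delta> by (intro C(2) test_functions_UNIV[OF \<phi>]) simp
      also have "\<dots> \<le> ennreal (\<delta> powr \<gamma>) * ?g + ennreal (C * (\<delta> powr \<gamma>) powr (- \<beta>)) * (ennreal (P * \<delta> powr (p * real m)) * (ennreal N * ?g))"
        by (intro add_left_mono mult_left_mono order_trans[OF P(2)[OF \<delta> \<phi>]] DN) auto
      also have "\<dots> = ennreal (\<delta> powr \<gamma>) * ?g + ennreal (C * P * N * ((\<delta> powr \<gamma>) powr (- \<beta>) * \<delta> powr (p * real m))) * ?g"
        using C P N by (simp add: ennreal_mult mult_ac)
      also have "(\<delta> powr \<gamma>) powr (- \<beta>) * \<delta> powr (p * real m) = \<delta> powr \<gamma>"
        by (simp add: powr_powr powr_add[symmetric] pm algebra_simps)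
      also have "ennreal (\<delta> powr \<gamma>) * ?g + ennreal (C * P * N * \<delta> powr \<gamma>) * ?g = ennreal ((1 + C * P * N) * \<delta> powr \<gamma>) * ?g"
        using C P N by (simp add: distrib_right)
      finally show "energy p \<theta> (\<lambda>x. V x * \<phi> x) \<le> ennreal ((1 + C * P * N) * \<delta> powr \<gamma>) * ?g" .
    qed
  next
    assume "\<exists>C'>0. \<forall>\<delta>>0. \<forall>x\<^sub>0. \<forall>\<phi>\<in>test_functions (ball x\<^sub>0 \<delta>). energy p \<theta> (\<lambda>x. V x * \<phi> x)
      \<le> ennreal (C' * \<delta> powr \<gamma>) * energy p \<theta> (grad_norm m \<phi>)"
    then obtain C' where C': "0 < C'" "\<And>\<delta> x0 \<phi>. 0 < \<delta> \<Longrightarrow> \<phi> \<in> test_functions (ball x0 \<delta>) \<Longrightarrow>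
      energy p \<theta> (\<lambda>x. V x * \<phi> x) \<le> ennreal (C' * \<delta> powr \<gamma>) * energy p \<theta> (grad_norm m \<phi>)"
      by blast
    show "\<exists>C>0. \<forall>\<epsilon>>0. \<forall>\<phi>\<in>test_functions UNIV. energy p \<theta> (\<lambda>x. V x * \<phi> x)
      \<le> ennreal \<epsilon> * energy p \<theta> (grad_norm m \<phi>) + ennreal (C * \<epsilon> powr (- \<beta>)) * energy p \<theta> \<phi>"
    \<comment> \<open>Any nonzero test function serves as cutoff, because \<open>C\<close> may depend on it. If there were
      none, every \<open>\<phi>\<close> would vanish, and with it the left-hand side.\<close>
    proof (cases "\<exists>\<eta>\<in>test_functions (UNIV::(real^'n) set). \<exists>z. \<eta> z \<noteq> 0")
      case False
      have "energy p \<theta> (\<lambda>x. V x * \<phi> x) = 0" if "\<phi> \<in> test_functions UNIV" for \<phi>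
        using False that p by (auto simp: energy_def)
      then show ?thesis by (intro exI[of _ 1]) auto
    next
      case True
      then obtain \<eta> and z :: "real^'n" where \<eta>: "\<eta> \<in> test_functions UNIV" "\<eta> z \<noteq> 0" by blast
      have "\<exists>K>0. \<forall>\<delta>>0. \<forall>\<phi>\<in>test_functions UNIV. energy p \<theta> (\<lambda>x. V x * \<phi> x)
        \<le> ennreal (K * \<delta> powr \<gamma>) * (deriv_energy p \<theta> m \<phi> + ennreal (\<delta> powr - (p * real m)) * energy p \<theta> \<phi>)"
        by (rule local_estimate_imp_scaled_estimate[OF n\<theta> \<theta>(2) p L1_loc_borel_measurable[OF V(1)] \<eta> C'(1)])
          (rule C'(2))
      then obtain K where K: "0 < K" "\<And>\<delta> \<phi>. 0 < \<delta> \<Longrightarrow> \<phi> \<in> test_functions UNIV \<Longrightarrow> energy p \<theta> (\<lambda>x. V x * \<phi> x)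
        \<le> ennreal (K * \<delta> powr \<gamma>) * (deriv_energy p \<theta> m \<phi> + ennreal (\<delta> powr - (p * real m)) * energy p \<theta> \<phi>)"
        by blast
      define Q where "Q = K * N"
      have Q: "0 < Q" "K \<le> Q" using K N by (auto simp: Q_def)
      show ?thesis
      proof (intro exI conjI allI impI ballI)
        show "0 < Q powr (\<beta> + 1)" using Q by simp
        fix \<epsilon> :: real and \<phi> :: "real^'n \<Rightarrow> real"
        assume \<epsilon>: "0 < \<epsilon>" and \<phi>: "\<phi> \<in> test_functions UNIV"
        \<comment> \<open>The scale at which the coefficient \<open>Q * \<delta> powr \<gamma>\<close> of the gradient term is exactly \<open>\<epsilon>\<close>.\<close>
        define \<delta> where "\<delta> = (\<epsilon> / Q) powr (1 / \<gamma>)"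
        have \<delta>: "0 < \<delta>" using \<epsilon> Q by (simp add: \<delta>_def)
        have \<delta>\<gamma>: "\<delta> powr \<gamma> = \<epsilon> / Q" using \<epsilon> Q \<gamma> by (simp add: \<delta>_def powr_powr)
        let ?g = "energy p \<theta> (grad_norm m \<phi>)" and ?e = "energy p \<theta> \<phi>"
        have "energy p \<theta> (\<lambda>x. V x * \<phi> x) \<le> ennreal (K * \<delta> powr \<gamma>) * (ennreal N * ?g + ennreal (\<delta> powr - (p * real m)) * ?e)"
          by (intro order_trans[OF K(2)[OF \<delta> \<phi>]] mult_left_mono add_right_mono DN) auto
        also have "\<dots> = ennreal (Q * \<delta> powr \<gamma>) * ?g + ennreal (K * (\<delta> powr \<gamma> * \<delta> powr - (p * real m))) * ?e"
          using K N by (simp add: Q_def ennreal_mult distrib_left mult_ac)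
        also have "\<dots> \<le> ennreal (Q * \<delta> powr \<gamma>) * ?g + ennreal (Q * (\<delta> powr \<gamma> * \<delta> powr - (p * real m))) * ?e"
          using Q by (intro add_left_mono mult_right_mono ennreal_leI) auto
        also have "\<delta> powr \<gamma> * \<delta> powr - (p * real m) = (\<delta> powr \<gamma>) powr - \<beta>"
          by (simp add: powr_powr powr_add[symmetric] pm algebra_simps)
        also have "Q * (\<delta> powr \<gamma>) powr - \<beta> = Q powr (\<beta> + 1) * \<epsilon> powr - \<beta>"
          using Q \<epsilon> by (simp add: \<delta>\<gamma> powr_divide powr_minus powr_add field_simps)
        also have "Q * \<delta> powr \<gamma> = \<epsilon>" using Q by (simp add: \<delta>\<gamma>)
        finally show "energy p \<theta> (\<lambda>x. V x * \<phi> x) \<le> ennreal \<epsilon> * ?g + ennreal (Q powr (\<beta> + 1) * \<epsilon> powr - \<beta>) * ?e" .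
      qed
    qed
  qed
qed

end
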